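(* For any $\gamma\in(0,1)$, if there is a $\gamma$-OCS, then there is an algorithm for edge-weighted online bipartite matching with competitive ratio $$\Gamma=\frac{3+2\gamma}{6+3\gamma}.$$
   Context: Edge-weighted online bipartite matching with free disposal: offline vertices $L$ are known in advance. Online vertices $j\in R$ arrive one at a time, and on arrival the weights $w_{ij}\ge 0$ ($i\in L$) are revealed. The algorithm must irrevocably assign $j$ to at most one offline vertex before the next arrival. An offline vertex may be assigned several online vertices but contributes only the maximum weight among them. A randomized algorithm is $\Gamma$-competitive if its expected total value is at least $\Gamma$ times the optimal offline matching weight on every instance. Fix a set of ground elements. A $2$-discrete OCS is an online (randomized) algorithm that at each time step $j=1,2,\dots$ receives a multiset $A_j$ of two ground elements and irrevocably selects one element of $A_j$ as the winner. A set of time steps $S\subseteq\mathbb N$ is consecutive if $S=\{j_1,j_1+1,\dots,j_2\}$ for some $j_1<j_2$. For an element $i$, $\mathrm{count}_i(S)$ is the total number of times (with multiplicity) that $i$ appears in the multisets $A_j$, $j\in S$. For $\gamma\in[0,1]$, a $\gamma$-OCS is a $2$-discrete OCS such that, for any element $i$ and any pairwise disjoint consecutive sets of time steps $S_1,\dots,S_k$, the probability that $i$ is never selected at a time step in $S_1\cup\dots\cup S_k$ is at most $$\prod_{\ell=1}^k 2^{-\mathrm{count}_i(S_\ell)}(1-\gamma)^{(\mathrm{count}_i(S_\ell)-1)_+},$$ where $(x)_+=\max(x,0)$. *)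

theory Defs
  imports "HOL-Probability.Probability"
begin

text \<open>
  A randomized online algorithm is given by the conditional law of its next decision, given the
  inputs and decisions so far and the current input. Since decisions are discrete, every
  randomized online algorithm (with arbitrary internal randomness) facing a fixed input sequence
  has this form.
\<close>

type_synonym ('i, 'o) online_alg = "('i \<times> 'o) list \<Rightarrow> 'i \<Rightarrow> 'o pmf"

text \<open>The law of the complete history, oldest step first, when continuing from history \<open>h\<close>.\<close>

primrec run_from :: "('i, 'o) online_alg \<Rightarrow> ('i \<times> 'o) list \<Rightarrow> 'i list \<Rightarrow> ('i \<times> 'o) list pmf" where
  "run_from alg h [] = return_pmf h"
| "run_from alg h (x # xs) = bind_pmf (alg h x) (\<lambda>y. run_from alg (h @ [(x, y)]) xs)"

definition run :: "('i, 'o) online_alg \<Rightarrow> 'i list \<Rightarrow> ('i \<times> 'o) list pmf" where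
  "run alg xs = run_from alg [] xs"

type_synonym 'a selector = "('a multiset, 'a) online_alg"

definition two_discrete_OCS :: "'a set \<Rightarrow> 'a selector \<Rightarrow> bool" where
  "two_discrete_OCS G ocs \<longleftrightarrow>
     (\<forall>h A. size A = 2 \<and> set_mset A \<subseteq> G \<longrightarrow> set_pmf (ocs h A) \<subseteq> set_mset A)"

definition consecutive :: "nat set \<Rightarrow> bool" where
  "consecutive S \<longleftrightarrow> (\<exists>j1 j2. j1 < j2 \<and> S = {j1..j2})"

definition count_in :: "'a multiset list \<Rightarrow> 'a \<Rightarrow> nat set \<Rightarrow> nat" where
  "count_in As i S = (\<Sum>j\<in>S. count (As ! j) i)"

text \<open>
  Time steps are numbered from 0. The event below involves finitely many steps only, so it suffices
  to quantify over finite input sequences \<open>As\<close>. The truncated subtraction on \<^typ>\<open>nat\<close> in the last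
  exponent is the positive part.
\<close>

definition gamma_OCS :: "real \<Rightarrow> 'a set \<Rightarrow> 'a selector \<Rightarrow> bool" where
  "gamma_OCS \<gamma> G ocs \<longleftrightarrow> two_discrete_OCS G ocs \<and>
     (\<forall>As i (k :: nat) (S :: nat \<Rightarrow> nat set).
        (\<forall>A\<in>set As. size A = 2 \<and> set_mset A \<subseteq> G) \<and> i \<in> G \<and>
        (\<forall>l<k. consecutive (S l) \<and> S l \<subseteq> {..<length As}) \<and>
        disjoint_family_on S {..<k} \<longrightarrow>
        measure_pmf.prob (run ocs As) {h. \<forall>j\<in>(\<Union>l<k. S l). snd (h ! j) \<noteq> i}
          \<le> (\<Prod>l<k. (1 / 2) ^ count_in As i (S l) * (1 - \<gamma>) ^ (count_in As i (S l) - 1)))"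

text \<open>
  An online vertex is represented by its weight vector; the decision \<open>Some i\<close> assigns it to the
  offline vertex \<open>i\<close>, and \<open>None\<close> leaves it unassigned. The algorithm knows the set of offline
  vertices, but not the number of online ones.
\<close>

type_synonym 'l matching_alg = "'l set \<Rightarrow> ('l \<Rightarrow> real, 'l option) online_alg"

definition is_matching_alg :: "'l matching_alg \<Rightarrow> bool" where
  "is_matching_alg alg \<longleftrightarrow>
     (\<forall>L h w. finite L \<longrightarrow> set_pmf (alg L h w) \<subseteq> insert None (Some ` L))"

text \<open>Free disposal: only the heaviest assigned vertex counts. Inserting 0 gives
  contribution 0 to offline vertices with nothing assigned.\<close>

definition assigned_value :: "'l set \<Rightarrow> (('l \<Rightarrow> real) \<times> 'l option) list \<Rightarrow> real" where
  "assigned_value L h = (\<Sum>i\<in>L. Max (insert 0 {w i | w. (w, Some i) \<in> set h}))"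

definition is_matching :: "'l set \<Rightarrow> nat \<Rightarrow> ('l \<times> nat) set \<Rightarrow> bool" where
  "is_matching L n M \<longleftrightarrow> M \<subseteq> L \<times> {..<n} \<and> inj_on fst M \<and> inj_on snd M"

definition optimal_matching_weight :: "'l set \<Rightarrow> ('l \<Rightarrow> real) list \<Rightarrow> real" where
  "optimal_matching_weight L ws =
     Max ((\<lambda>M. \<Sum>(i, j)\<in>M. (ws ! j) i) ` {M. is_matching L (length ws) M})"

definition competitive :: "real \<Rightarrow> 'l matching_alg \<Rightarrow> bool" where
  "competitive \<Gamma> alg \<longleftrightarrow>
     (\<forall>L ws. finite L \<and> (\<forall>w\<in>set ws. \<forall>i\<in>L. 0 \<le> w i) \<longrightarrow>
        measure_pmf.expectation (run (alg L) ws) (assigned_value L)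
          \<ge> \<Gamma> * optimal_matching_weight L ws)"

end

theory Submission
  imports Defs
begin

text \<open>
  The algorithm is an online primal-dual algorithm in the complementary cumulative distribution
  view: the expected value of an offline vertex \<open>i\<close> is the integral over all levels \<open>w > 0\<close> of the
  probability that \<open>i\<close> receives an online vertex of weight at least \<open>w\<close>. On arrival of an online
  vertex each \<open>i\<close> bids the integral \<open>R\<^sub>i\<close> of a rate that depends, at level \<open>w\<close>, on the number of
  earlier randomized assignments involving \<open>i\<close> with weight at least \<open>w\<close>. The two highest bidders are
  handed to the OCS unless the top bid dominates the second so much that assigning to the top bidder
  deterministically pays more. The guarantee of the OCS improves only along consecutive appearances,
  so an assignment below level \<open>w\<close> interrupts a run at level \<open>w\<close>; the negative part of the rate pays
  for this loss in advance. The queries to the OCS depend on the input only, not on earlier winners.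

  This analysis needs \<open>\<gamma>\<close> to be bounded away from 1, and indeed no \<open>\<gamma>\<close>-OCS exists for
  \<open>\<gamma> > 1/3\<close>: on the queries \<open>ab, ac, ab\<close>, either \<open>c\<close> loses the second one or one of \<open>a\<close> and \<open>b\<close>
  loses twice, so \<open>1 \<le> 1/2 + 3 * (1 - \<gamma>)/4\<close>.
\<close>

section \<open>Laws of online algorithms\<close>

lemma run_from_append:
  "run_from alg h (xs @ ys) = bind_pmf (run_from alg h xs) (\<lambda>h'. run_from alg h' ys)"
  by (induction xs arbitrary: h) (simp_all add: bind_return_pmf bind_assoc_pmf)

lemma run_append: "run alg (xs @ ys) = bind_pmf (run alg xs) (\<lambda>h. run_from alg h ys)"
  by (simp add: run_def run_from_append)

lemma set_pmf_run_fromD: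
  "h' \<in> set_pmf (run_from alg h xs) \<Longrightarrow> \<exists>ys. h' = h @ ys \<and> map fst ys = xs"
proof (induction xs arbitrary: h)
  case (Cons x xs)
  then obtain y where "h' \<in> set_pmf (run_from alg (h @ [(x, y)]) xs)"
    by auto
  from Cons.IH[OF this] show ?case
    by auto
qed simp

lemma map_fst_run: "h \<in> set_pmf (run alg xs) \<Longrightarrow> map fst h = xs"
  using set_pmf_run_fromD[of h alg "[]" xs] by (auto simp: run_def)

text \<open>Later inputs cannot influence earlier decisions. Through this consistency the law of the
  OCS on a growing query list meets the \<open>marginal\<close> hypothesis of
  \<open>ex_alg_run_eq\<close>.\<close>

lemma map_take_run: "map_pmf (take (length xs)) (run alg (xs @ ys)) = run alg xs"
proof -
  have "map_pmf (take (length xs)) (run alg (xs @ ys)) =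
      bind_pmf (run alg xs) (\<lambda>h. map_pmf (take (length xs)) (run_from alg h ys))"
    by (simp add: run_append map_bind_pmf)
  also have "\<dots> = bind_pmf (run alg xs) return_pmf"
  proof (rule bind_pmf_cong[OF refl])
    fix h assume h: "h \<in> set_pmf (run alg xs)"
    have "length h = length xs"
      using map_fst_run[OF h] by (metis length_map)
    then have "map_pmf (take (length xs)) (run_from alg h ys) = map_pmf (\<lambda>_. h) (run_from alg h ys)"
      by (intro map_pmf_cong refl) (auto dest!: set_pmf_run_fromD)
    then show "map_pmf (take (length xs)) (run_from alg h ys) = return_pmf h"
      by (simp add: map_pmf_const)
  qed
  finally show ?thesis
    by (simp add: bind_return_pmf')
qed

lemma set_pmf_run_decision:
  assumes "\<And>h x. x \<in> set xs \<Longrightarrow> set_pmf (alg h x) \<subseteq> D x"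
    and "h \<in> set_pmf (run alg xs)" and "j < length xs"
  shows "snd (h ! j) \<in> D (xs ! j)"
proof -
  have "snd (h ! (length h0 + j)) \<in> D (xs ! j)"
    if "h \<in> set_pmf (run_from alg h0 xs)" "j < length xs"
      "\<And>h x. x \<in> set xs \<Longrightarrow> set_pmf (alg h x) \<subseteq> D x" for h0
    using that
  proof (induction xs arbitrary: h0 j)
    case (Cons x xs)
    then obtain y where y: "y \<in> set_pmf (alg h0 x)"
      and h: "h \<in> set_pmf (run_from alg (h0 @ [(x, y)]) xs)"
      by auto
    show ?case
    proof (cases j)
      case 0
      have "y \<in> D x"
        using y Cons.prems(3) by auto
      then show ?thesis
        using set_pmf_run_fromD[OF h] 0 by (auto simp: nth_append)
    next
      case (Suc j')
      then show ?thesis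
        using Cons.IH[OF h, of j'] Cons.prems by auto
    qed
  qed simp
  from this[of "[]"] show ?thesis
    using assms by (simp add: run_def)
qed

text \<open>
  Kuhn's theorem: a family of history laws in which every law is the marginal of those of the
  longer inputs is realised by the conditional laws of the next decision. This is what allows an
  online algorithm to keep private random state.
\<close>

lemma ex_alg_run_eq:
  fixes P :: "'i list \<Rightarrow> ('i \<times> 'o) list pmf"
  assumes inputs: "\<And>xs h. h \<in> set_pmf (P xs) \<Longrightarrow> map fst h = xs"
    and marginal: "\<And>xs x. map_pmf butlast (P (xs @ [x])) = P xs"
    and decisions: "\<And>xs h. h \<in> set_pmf (P xs) \<Longrightarrow> snd ` set h \<subseteq> D" and "d \<in> D"
  shows "\<exists>alg. (\<forall>xs. run alg xs = P xs) \<and> (\<forall>h x. set_pmf (alg h x) \<subseteq> D)"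
proof -
  \<comment> \<open>The next decision is the last entry of the longer history, conditioned on the
    past. Histories of probability zero admit no conditioning and get the default
    \<open>d\<close>.\<close>
  define alg where "alg h x = (if h \<in> set_pmf (P (map fst h))
    then map_pmf (snd \<circ> last) (cond_pmf (P (map fst h @ [x])) {h'. butlast h' = h})
    else return_pmf d)" for h x
  have ne: "set_pmf (P (xs @ [x])) \<inter> {h'. butlast h' = h} \<noteq> {}" if "h \<in> set_pmf (P xs)" for h xs x
    using that unfolding marginal[of xs x, symmetric] by auto
  have last_in: "h \<noteq> [] \<and> last h \<in> set h" if "h \<in> set_pmf (P (xs @ [x]))" for h xs x
    using inputs[OF that] by (cases h) auto
  have "run alg xs = P xs" for xs
  proof (induction xs rule: rev_induct)
    case Nil
    have "set_pmf (P []) \<subseteq> {[]}"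
      using inputs[of _ "[]"] by auto
    then show ?case
      by (simp add: run_def set_pmf_subset_singleton)
  next
    case (snoc x xs)
    have "run alg (xs @ [x]) = bind_pmf (P xs) (\<lambda>h. map_pmf (\<lambda>y. h @ [(x, y)]) (alg h x))"
      by (simp add: run_append snoc.IH map_pmf_def)
    also have "\<dots> = bind_pmf (P xs) (\<lambda>h. cond_pmf (P (xs @ [x])) {h'. butlast h' = h})"
    proof (rule bind_pmf_cong[OF refl])
      fix h assume h: "h \<in> set_pmf (P xs)"
      have "map_pmf (\<lambda>y. h @ [(x, y)]) (alg h x) =
          map_pmf (\<lambda>h'. h @ [(x, snd (last h'))]) (cond_pmf (P (xs @ [x])) {h'. butlast h' = h})"
        using h inputs[OF h] by (simp add: alg_def map_pmf_comp)
      also have "\<dots> = map_pmf (\<lambda>h'. h') (cond_pmf (P (xs @ [x])) {h'. butlast h' = h})"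
      proof (intro map_pmf_cong refl)
        fix h' assume "h' \<in> set_pmf (cond_pmf (P (xs @ [x])) {h'. butlast h' = h})"
        then have h': "h' \<in> set_pmf (P (xs @ [x]))" "butlast h' = h"
          using ne[OF h, of x] by auto
        from inputs[OF h'(1)] last_in[OF h'(1)] have "fst (last h') = x"
          by (metis last_map last_snoc)
        with h' last_in[OF h'(1)] show "h @ [(x, snd (last h'))] = h'"
          by (metis append_butlast_last_id prod.collapse)
      qed
      finally show "map_pmf (\<lambda>y. h @ [(x, y)]) (alg h x) =
          cond_pmf (P (xs @ [x])) {h'. butlast h' = h}"
        by simp
    qed
    also have "\<dots> = P (xs @ [x])"
    proof (rule bind_cond_pmf_cancel)
      show "set_pmf (P (xs @ [x])) \<inter> {h'. butlast h' = h} \<noteq> {}" if "h \<in> set_pmf (P xs)" for h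
        using ne[OF that] .
      show "set_pmf (P xs) \<inter> {h. butlast h' = h} \<noteq> {}" if "h' \<in> set_pmf (P (xs @ [x]))" for h'
        using that unfolding marginal[of xs x, symmetric] by auto
      show "measure_pmf.prob (P (xs @ [x])) {h'. butlast h' = h} =
          measure_pmf.prob (P xs) {h. butlast h' = h}" if "butlast h' = h" for h h'
        using that unfolding marginal[of xs x, symmetric] by (simp add: vimage_def)
    qed
    finally show ?case .
  qed
  moreover have "set_pmf (alg h x) \<subseteq> D" for h x
  proof (cases "h \<in> set_pmf (P (map fst h))")
    case True
    then have "set_pmf (alg h x) \<subseteq> (snd \<circ> last) ` set_pmf (P (map fst h @ [x]))"
      using ne[OF True, of x] by (auto simp: alg_def)
    also have "\<dots> \<subseteq> D"
      using decisions last_in by fastforce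
    finally show ?thesis .
  qed (simp add: alg_def \<open>d \<in> D\<close>)
  ultimately show ?thesis
    by blast
qed

section \<open>An upper bound on the quality of an OCS\<close>

lemma gamma_OCS_le_third:
  fixes a b c :: 'a
  assumes "gamma_OCS \<gamma> G ocs" and "a \<in> G" "b \<in> G" "c \<in> G" and "distinct [a, b, c]"
  shows "\<gamma> \<le> 1 / 3"
proof -
  define As where "As = [{#a, b#}, {#a, c#}, {#a, b#}]"
  define p where "p = measure_pmf.prob (run ocs As)"
  have ocs: "set_pmf (ocs h A) \<subseteq> set_mset A" if "size A = 2" "set_mset A \<subseteq> G" for h A
    using assms(1) that by (auto simp: gamma_OCS_def two_discrete_OCS_def)
  have bound: "p {h. \<forall>j\<in>{j1..j2}. snd (h ! j) \<noteq> i}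
      \<le> (1 / 2) ^ count_in As i {j1..j2} * (1 - \<gamma>) ^ (count_in As i {j1..j2} - 1)"
    if "i \<in> G" "j1 < j2" "j2 < 3" for i j1 j2
  proof -
    have "consecutive {j1..j2}" "{j1..j2} \<subseteq> {..<length As}" "\<forall>A\<in>set As. size A = 2 \<and> set_mset A \<subseteq> G"
      using that assms by (auto simp: consecutive_def As_def)
    then show ?thesis
      using assms(1) that unfolding gamma_OCS_def p_def
      by (elim conjE allE[of _ As] allE[of _ i] allE[of _ "1::nat"] allE[of _ "\<lambda>_. {j1..j2}"])
        (auto simp: disjoint_family_on_def lessThan_Suc)
  qed
  have ivl: "{0..1} = {0, 1::nat}" "{1..2} = {1, 2::nat}" "{0..2} = {0, 1, 2::nat}"
    by auto
  \<comment> \<open>Consecutive sets have at least two elements, so the single query of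
    \<open>c\<close>, at step 1, is placed in \<open>{1..2}\<close>.\<close>
  have cnt: "count_in As a {0..1} = 2" "count_in As a {1..2} = 2"
    "count_in As b {0..2} = 2" "count_in As c {1..2} = 1"
    unfolding ivl using assms(5) by (auto simp: count_in_def As_def)
  have "p {h. \<forall>j\<in>{0..1}. snd (h ! j) \<noteq> a} \<le> (1 - \<gamma>) / 4"
    using bound[of a 0 1] assms unfolding cnt by (simp add: power2_eq_square)
  moreover have "p {h. \<forall>j\<in>{1..2}. snd (h ! j) \<noteq> a} \<le> (1 - \<gamma>) / 4"
    using bound[of a 1 2] assms unfolding cnt by (simp add: power2_eq_square)
  moreover have "p {h. \<forall>j\<in>{0..2}. snd (h ! j) \<noteq> b} \<le> (1 - \<gamma>) / 4"
    using bound[of b 0 2] assms unfolding cnt by (simp add: power2_eq_square)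
  moreover have "p {h. \<forall>j\<in>{1..2}. snd (h ! j) \<noteq> c} \<le> 1 / 2"
    using bound[of c 1 2] assms unfolding cnt by simp
  moreover have "1 \<le> p {h. \<forall>j\<in>{0..1}. snd (h ! j) \<noteq> a} + p {h. \<forall>j\<in>{1..2}. snd (h ! j) \<noteq> a}
    + p {h. \<forall>j\<in>{0..2}. snd (h ! j) \<noteq> b} + p {h. \<forall>j\<in>{1..2}. snd (h ! j) \<noteq> c}"
    (is "1 \<le> p ?A + p ?B + p ?C + p ?D")
  proof -
    have "p (?A \<union> ?B \<union> ?C \<union> ?D) = 1"
      unfolding p_def
    proof (subst measure_pmf.prob_eq_1, simp, subst AE_measure_pmf_iff, intro ballI)
      fix h assume h: "h \<in> set_pmf (run ocs As)"
      have "snd (h ! j) \<in># As ! j" if "j < 3" for j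
      proof (rule set_pmf_run_decision[OF _ h])
        show "set_pmf (ocs h' A) \<subseteq> set_mset A" if "A \<in> set As" for h' A
          using that assms(2-4) by (intro ocs) (auto simp: As_def)
      qed (use that in \<open>simp add: As_def\<close>)
      from this[of 0] this[of 1] this[of 2]
      have "snd (h ! 0) \<in> {a, b}" "snd (h ! 1) \<in> {a, c}" "snd (h ! 2) \<in> {a, b}"
        by (auto simp: As_def numeral_2_eq_2)
      \<comment> \<open>If \<open>c\<close> wins step 1, then \<open>a\<close> loses it. A further
        loss of \<open>a\<close> at step 0 or 2 gives \<open>?A\<close> or \<open>?B\<close>;
        otherwise \<open>a\<close> wins both and \<open>b\<close> loses twice.\<close>
      then show "h \<in> ?A \<union> ?B \<union> ?C \<union> ?D"
        unfolding ivl using assms(5) by auto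
    qed
    moreover have "p (?A \<union> ?B \<union> ?C \<union> ?D) \<le> p ?A + p ?B + p ?C + p ?D"
      unfolding p_def
      by (intro order_trans[OF measure_Un_le] add_mono) auto
    ultimately show ?thesis
      by simp
  qed
  ultimately show ?thesis
    by simp
qed

section \<open>The primal-dual analysis at a single level\<close>

text \<open>
  The state of an offline vertex at a level \<open>w\<close>: \<open>Dead\<close> after a deterministic assignment of weight at
  least \<open>w\<close>, and \<open>Live k m c\<close> after \<open>k\<close> randomized ones that form \<open>m\<close> maximal runs not interrupted by
  randomized assignments of smaller weight, where \<open>c\<close> says that the last run can still be continued.
\<close>

datatype level_state = Dead | Live nat nat bool

text \<open>An invariant of reachable states: no run is empty, so the subtraction
  \<open>k - m\<close> in \<open>miss\<close> never truncates.\<close>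

fun level_valid :: "level_state \<Rightarrow> bool" where
  "level_valid Dead \<longleftrightarrow> True"
| "level_valid (Live k m c) \<longleftrightarrow> m \<le> k \<and> (k > 0 \<longrightarrow> m > 0) \<and> (c \<longrightarrow> m > 0)"

fun rand_step :: "bool \<Rightarrow> level_state \<Rightarrow> level_state" where
  "rand_step x Dead = Dead"
| "rand_step x (Live k m c) =
    (if x then Live (Suc k) (if c then m else Suc m) True else Live k m False)"

definition det_step :: "bool \<Rightarrow> level_state \<Rightarrow> level_state" where
  "det_step x s = (if x then Dead else s)"

lemma level_valid_rand_step: "level_valid s \<Longrightarrow> level_valid (rand_step x s)"
  by (cases s) auto

lemma level_valid_det_step: "level_valid s \<Longrightarrow> level_valid (det_step x s)"
  by (simp add: det_step_def)

locale level_analysis =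
  fixes \<gamma> :: real
  assumes gamma_pos: "0 < \<gamma>" and gamma_le_third: "\<gamma> \<le> 1 / 3"
begin

definition \<Gamma> :: real where
  "\<Gamma> = (3 + 2 * \<gamma>) / (6 + 3 * \<gamma>)"

definition miss_bound :: "nat \<Rightarrow> real" where
  "miss_bound k = (1 / 2) ^ k * (1 - \<gamma>) ^ (k - 1)"

text \<open>
  The constants solve \<open>2 * gain k + A k = \<Gamma>\<close> and \<open>gain k + (A (k + 1) - A k) = g k\<close>, where \<open>A k\<close> is the
  offline dual after \<open>k\<close> randomized assignments, \<open>A 0 = 0\<close>, and \<open>g k\<close> is the guaranteed decrease of
  the miss probability if a run is continued: \<open>g 0 = 1/2\<close> and \<open>g k = (1 + \<gamma>) / 2 * miss_bound k\<close>.
\<close>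

definition gain :: "nat \<Rightarrow> real" where
  "gain k = (if k = 0 then \<Gamma> / 2 else (1 + \<gamma>) / (2 * (2 + \<gamma>)) * miss_bound k)"

fun online_gain :: "level_state \<Rightarrow> real" where
  "online_gain Dead = 0"
| "online_gain (Live k m c) = gain k"

text \<open>The product of \<open>miss_bound\<close> over \<open>m\<close> nonempty runs of total
  length \<open>k\<close>: each run forgoes one factor \<open>1 - \<gamma>\<close>.\<close>

fun miss :: "level_state \<Rightarrow> real" where
  "miss Dead = 0"
| "miss (Live k m c) = (1 / 2) ^ k * (1 - \<gamma>) ^ (k - m)"

text \<open>
  Starting a new run at the next assignment loses \<open>credit\<close> compared to continuing the old one; it is
  saved when the old run is interrupted.
\<close>

fun credit :: "level_state \<Rightarrow> real" where
  "credit Dead = 0"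
| "credit (Live k m c) = (if k = 0 \<or> c then 0 else \<gamma> / 2 * miss_bound k)"

definition offline_dual :: "level_state \<Rightarrow> real" where
  "offline_dual s = \<Gamma> - 2 * online_gain s"

text \<open>What the guaranteed probability \<open>1 - miss s\<close> of reaching the level leaves
  once the offline dual and the credit are set aside; this budget finances the online duals.\<close>

definition surplus :: "level_state \<Rightarrow> real" where
  "surplus s = 1 - miss s - offline_dual s - credit s"

text \<open>Both branches are set so that \<open>offline_dual s + 2 * level_rate x s\<close> is
  \<open>\<Gamma>\<close> at the levels to be covered and 0 above them.\<close>

definition level_rate :: "bool \<Rightarrow> level_state \<Rightarrow> real" where
  "level_rate x s = (if x then online_gain s else - offline_dual s / 2)"

section \<open>Estimates for the constants\<close>

lemma \<Gamma>_eq: "\<Gamma> = (3 + 2 * \<gamma>) / 3 * (1 / (2 + \<gamma>))"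
proof -
  have "6 + 3 * \<gamma> = 3 * (2 + \<gamma>)"
    by simp
  then show ?thesis
    unfolding \<Gamma>_def by (metis times_divide_times_eq mult.right_neutral)
qed

lemma gain_eq: "k > 0 \<Longrightarrow> gain k = (1 + \<gamma>) / 2 * (1 / (2 + \<gamma>)) * miss_bound k"
  by (simp add: gain_def)

lemma gain_0: "gain 0 = (3 + 2 * \<gamma>) / 6 * (1 / (2 + \<gamma>))"
  by (simp add: gain_def \<Gamma>_eq)

text \<open>Replacing \<open>\<gamma> * z\<close> by \<open>1 - 2 * z\<close> eliminates the
  denominator \<open>2 + \<gamma>\<close> from the computations below.\<close>

lemma inverse_two_plus_gamma:
  obtains z where "z = 1 / (2 + \<gamma>)" "z > 0" "\<gamma> * z = 1 - 2 * z"
  using that[of "1 / (2 + \<gamma>)"] gamma_pos by (simp add: field_simps)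

lemma gamma_lt_1: "\<gamma> < 1"
  using gamma_le_third by simp

lemma miss_bound_nonneg: "0 \<le> miss_bound k"
  using gamma_lt_1 by (simp add: miss_bound_def)

lemma miss_bound_Suc: "k > 0 \<Longrightarrow> miss_bound (Suc k) = (1 - \<gamma>) / 2 * miss_bound k"
  by (cases k) (simp_all add: miss_bound_def)

lemma miss_bound_le_half: "k > 0 \<Longrightarrow> miss_bound k \<le> 1 / 2"
proof (induction k)
  case (Suc k)
  show ?case
  proof (cases "k = 0")
    case False
    then have "miss_bound (Suc k) \<le> 1 * miss_bound k"
      unfolding miss_bound_Suc[OF False[THEN neq0_conv[THEN iffD1]]]
      using gamma_pos gamma_lt_1 miss_bound_nonneg by (intro mult_right_mono) auto
    with Suc False show ?thesis
      by simp
  qed (simp add: miss_bound_def)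
qed simp

lemma miss_bound_le_miss:
  assumes "0 < m" "m \<le> k"
  shows "miss_bound k \<le> miss (Live k m c)"
  unfolding miss_bound_def miss.simps using assms gamma_pos gamma_lt_1
  by (intro mult_left_mono power_decreasing) auto

lemma gain_pos_le:
  assumes "k > 0"
  shows "gain k \<le> (1 + \<gamma>) / 4 * (1 / (2 + \<gamma>))"
proof -
  have "gain k \<le> (1 + \<gamma>) / 2 * (1 / (2 + \<gamma>)) * (1 / 2)"
    unfolding gain_eq[OF assms] using gamma_pos miss_bound_le_half[OF assms]
    by (intro mult_left_mono mult_nonneg_nonneg) auto
  then show ?thesis
    by simp
qed

lemma gain_nonneg: "0 \<le> gain k"
  using gamma_pos miss_bound_nonneg by (auto simp: gain_def \<Gamma>_def)

lemma offline_dual_pos_ge: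
  assumes "k > 0"
  shows "offline_dual (Live k m c) \<ge> \<gamma> / 2"
proof -
  obtain z where z: "z = 1 / (2 + \<gamma>)" "z > 0" "\<gamma> * z = 1 - 2 * z"
    by (rule inverse_two_plus_gamma)
  have "(1 + \<gamma>) / 4 * z = 1 / 4 - z / 4" "(3 + 2 * \<gamma>) / 3 * z = 2 / 3 - z / 3"
    using z(3) by (simp_all add: field_simps)
  \<comment> \<open>In terms of \<open>z\<close> this reads
    \<open>\<gamma> / 2 \<le> 1 / 6 + z / 6\<close>, which \<open>\<gamma> \<le> 1 / 3\<close>
    guarantees.\<close>
  then have "\<gamma> / 2 + 2 * ((1 + \<gamma>) / 4 * z) \<le> (3 + 2 * \<gamma>) / 3 * z"
    using z(2) gamma_le_third by linarith
  then have "\<gamma> / 2 + 2 * ((1 + \<gamma>) / 4 * (1 / (2 + \<gamma>))) \<le> \<Gamma>"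
    unfolding \<Gamma>_eq z(1) .
  then show ?thesis
    using gain_pos_le[OF assms] unfolding offline_dual_def online_gain.simps by linarith
qed

lemma offline_dual_nonneg: "0 \<le> offline_dual s"
proof (cases s)
  case (Live k m c)
  then show ?thesis
    using offline_dual_pos_ge[of k m c] gamma_pos
    by (cases "k = 0") (auto simp: offline_dual_def gain_def)
qed (use gamma_pos in \<open>simp add: offline_dual_def \<Gamma>_def\<close>)

lemma offline_dual_le: "offline_dual s \<le> \<Gamma>"
  using gain_nonneg by (cases s) (auto simp: offline_dual_def)

lemma credit_nonneg: "0 \<le> credit s"
  using gamma_pos miss_bound_nonneg by (cases s) auto

text \<open>For an interrupted run, \<open>\<gamma> / 4\<close> lies between the two sides because
  \<open>miss_bound k \<le> 1 / 2\<close>. Hence the negative rate, half the dual, can fund the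
  credit.\<close>

lemma credit_le_half_offline_dual: "credit (Live k m c) \<le> offline_dual (Live k m c) / 2"
proof (cases "k = 0 \<or> c")
  case False
  then have "\<gamma> / 2 * miss_bound k \<le> \<gamma> / 2 * (1 / 2)"
    using gamma_pos miss_bound_le_half by (intro mult_left_mono) auto
  with False show ?thesis
    using offline_dual_pos_ge[of k m c] by simp
qed (use offline_dual_nonneg in auto)

text \<open>Putting \<open>A k = \<Gamma> - 2 * gain k\<close> into the second equation for the
  constants gives a recurrence with right-hand side \<open>g k\<close>. This is the case
  \<open>k = 0\<close>; \<open>gain_Suc\<close> is the rest.\<close>

lemma gain_0_1: "3 * gain 0 - 2 * gain (Suc 0) = 1 / 2"
proof -
  obtain z where z: "z = 1 / (2 + \<gamma>)" "z > 0" "\<gamma> * z = 1 - 2 * z"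
    by (rule inverse_two_plus_gamma)
  have "miss_bound (Suc 0) = 1 / 2"
    by (simp add: miss_bound_def)
  then show ?thesis
    unfolding gain_0 gain_eq[OF zero_less_Suc] z(1)[symmetric] using z(3) by (simp add: field_simps)
qed

lemma gain_Suc:
  assumes "k > 0"
  shows "3 * gain k - 2 * gain (Suc k) = (1 + \<gamma>) / 2 * miss_bound k"
proof -
  obtain z where z: "z = 1 / (2 + \<gamma>)" "z > 0" "\<gamma> * z = 1 - 2 * z"
    by (rule inverse_two_plus_gamma)
  have "3 * gain k - 2 * gain (Suc k) = (1 + \<gamma>) / 2 * miss_bound k * (2 * z + \<gamma> * z)"
    unfolding gain_eq[OF assms] gain_eq[OF zero_less_Suc] z(1)[symmetric] miss_bound_Suc[OF assms]
    by (simp add: field_simps)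
  then show ?thesis
    by (simp add: z(3))
qed

text \<open>A randomized assignment pays its own rate. For \<open>k > 0\<close> at a level it
  reaches, the slack is a nonnegative multiple of \<open>miss s - miss_bound k\<close>: the
  constants are tight for one unbroken run, and more runs leave more miss probability to
  remove.\<close>

lemma surplus_rand_step:
  assumes "level_valid s"
  shows "surplus (rand_step x s) - surplus s \<ge> level_rate x s"
proof (cases s)
  case Dead
  then show ?thesis
    using offline_dual_nonneg[of Dead] by (simp add: level_rate_def)
next
  case s: (Live k m c)
  show ?thesis
  proof (cases x)
    case False
    \<comment> \<open>Below the level only the credit changes, since the step closes the current
      run.\<close>
    have "surplus (rand_step x s) - surplus s = credit s - credit (Live k m False)"
      using False s by (simp add: surplus_def offline_dual_def)
    also have "\<dots> \<ge> - (offline_dual s / 2)"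
    proof -
      have "offline_dual (Live k m False) = offline_dual s"
        using s by (simp add: offline_dual_def)
      then show ?thesis
        using credit_nonneg[of s] credit_le_half_offline_dual[of k m False] by linarith
    qed
    finally show ?thesis
      using False by (simp add: level_rate_def)
  next
    case True
    define s' where "s' = rand_step x s"
    have s': "s' = Live (Suc k) (if c then m else Suc m) True"
      using s True by (simp add: s'_def)
    have *: "surplus s' - surplus s - level_rate x s =
        miss s - miss s' + credit s - (3 * gain k - 2 * gain (Suc k))"
      using s s' True by (simp add: surplus_def offline_dual_def level_rate_def)
    have "0 \<le> surplus s' - surplus s - level_rate x s"
    proof (cases "k = 0")
      case True
      then show ?thesis
        using assms s s' gain_0_1 unfolding * by auto
    next
      case False
      then have m: "0 < m" "m \<le> k"
        using assms s by auto
      note ge = miss_bound_le_miss[OF m, of c]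
      show ?thesis
      proof (cases c)
        case True
        have eqs: "miss s' = (1 - \<gamma>) / 2 * miss s" "credit s = 0"
          using s s' m True by (simp_all add: Suc_diff_le)
        then have "surplus s' - surplus s - level_rate x s =
            (1 + \<gamma>) / 2 * (miss s - miss_bound k)"
          unfolding * eqs using False gain_Suc[of k] by (simp add: field_simps)
        also have "\<dots> \<ge> 0"
          using ge s gamma_pos by auto
        finally show ?thesis .
      next
        case c: False
        \<comment> \<open>A fresh run merely halves the miss bound; the released credit supplies the
          missing \<open>\<gamma> / 2 * miss_bound k\<close>.\<close>
        have eqs: "miss s' = miss s / 2" "credit s = \<gamma> / 2 * miss_bound k"
          using s s' m c False by simp_all
        then have "surplus s' - surplus s - level_rate x s = (miss s - miss_bound k) / 2"
          unfolding * eqs using False gain_Suc[of k] by (simp add: field_simps)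
        also have "\<dots> \<ge> 0"
          using ge s by auto
        finally show ?thesis .
      qed
    qed
    then show ?thesis
      by (simp add: s'_def)
  qed
qed

text \<open>
  The factor \<open>4/3\<close> by which a deterministic assignment is preferred may be any number between
  \<open>(3 + 3 * \<gamma>) / (3 + 2 * \<gamma>)\<close> and \<open>2 / (1 + \<gamma>)\<close>.
\<close>

lemma surplus_det_step:
  assumes "level_valid s"
  shows "surplus (det_step x s) - surplus s \<ge> 4 / 3 * level_rate x s"
proof (cases s)
  case Dead
  then show ?thesis
    using offline_dual_nonneg[of Dead] by (simp add: level_rate_def det_step_def)
next
  case s: (Live k m c)
  show ?thesis
  proof (cases x)
    case False
    then show ?thesis
      using offline_dual_nonneg[of s] by (simp add: level_rate_def det_step_def)
  next
    case True
    have eq: "surplus (det_step x s) - surplus s - 4 / 3 * level_rate x s =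
        miss s + credit s - 10 / 3 * gain k"
      using s True by (simp add: surplus_def det_step_def level_rate_def offline_dual_def)
    \<comment> \<open>Here \<open>10 / 3\<close> is \<open>2 + 4 / 3\<close>: the offline dual rises
      by \<open>2 * gain k\<close> up to \<open>\<Gamma>\<close>, and the rate claims
      \<open>4 / 3 * gain k\<close>.\<close>
    have "10 / 3 * gain k \<le> miss s"
    proof (cases "k = 0")
      case True
      have "10 / 3 * gain 0 \<le> 1"
        using gamma_pos gamma_le_third by (simp add: gain_def \<Gamma>_def field_simps)
      then show ?thesis
        using assms s True by simp
    next
      case False
      then have "0 < m" "m \<le> k"
        using assms s by auto
      have "10 / 3 * gain k = (10 / 3 * ((1 + \<gamma>) / (2 * (2 + \<gamma>)))) * miss_bound k"
        using False by (simp add: gain_def)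
      also have "\<dots> \<le> 1 * miss_bound k"
        using gamma_pos gamma_le_third miss_bound_nonneg
        by (intro mult_right_mono) (auto simp: field_simps)
      also have "\<dots> \<le> miss s"
        using miss_bound_le_miss[OF \<open>0 < m\<close> \<open>m \<le> k\<close>] s by simp
      finally show ?thesis .
    qed
    with eq show ?thesis
      using credit_nonneg[of s] by linarith
  qed
qed

text \<open>The constant is half of \<open>4 / 3\<close>, so that
  \<open>2 * gain (Suc k) \<le> 4 / 3 * gain k\<close>, as the top bidder of a randomized assignment
  requires.\<close>

lemma gain_Suc_le: "gain (Suc k) \<le> 2 / 3 * gain k"
proof (cases "k = 0")
  case True
  have "gain 0 \<le> 3 / 10"
    using gamma_pos gamma_le_third by (simp add: gain_def \<Gamma>_def field_simps)
  then show ?thesis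
    using gain_0_1 True by simp
next
  case False
  have "gain (Suc k) = (1 - \<gamma>) / 2 * gain k"
    using False by (simp add: gain_def miss_bound_Suc)
  also have "\<dots> \<le> 2 / 3 * gain k"
    using gamma_pos gain_nonneg by (intro mult_right_mono) auto
  finally show ?thesis .
qed

lemma offline_dual_mono_rand_step: "offline_dual s \<le> offline_dual (rand_step x s)"
proof (cases s)
  case (Live k m c)
  have "gain (Suc k) \<le> gain k"
    using gain_Suc_le[of k] gain_nonneg[of k] by linarith
  with Live show ?thesis
    by (simp add: offline_dual_def)
qed simp

lemma offline_dual_mono_det_step: "offline_dual s \<le> offline_dual (det_step x s)"
  using offline_dual_le[of s] by (simp add: det_step_def offline_dual_def)

lemma offline_dual_plus_rate: "offline_dual s + 2 * level_rate x s = (if x then \<Gamma> else 0)"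
  by (simp add: level_rate_def offline_dual_def field_simps)

lemma online_gain_nonneg: "0 \<le> online_gain s"
  by (cases s) (auto simp: gain_nonneg)

text \<open>The top bidder is credited only \<open>4 / 3\<close> of its rate instead of twice; the
  rise of its own dual during the step makes up the difference.\<close>

lemma offline_dual_rand_step_plus_rate:
  "offline_dual (rand_step x s) + 4 / 3 * level_rate x s \<ge> (if x then \<Gamma> else 0)"
proof (cases x)
  case True
  have "3 * online_gain (rand_step x s) \<le> 2 * online_gain s"
    using gain_Suc_le True by (cases s) (auto simp: field_simps)
  with True show ?thesis
    by (simp add: level_rate_def offline_dual_def)
next
  case False
  have "offline_dual (rand_step x s) = offline_dual s"
    using False by (cases s) (auto simp: offline_dual_def)
  with False show ?thesis
    using offline_dual_nonneg[of s] by (simp add: level_rate_def)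
qed

lemma offline_dual_det_step_plus_rate:
  "offline_dual (det_step x s) + 4 / 3 * level_rate x s \<ge> (if x then \<Gamma> else 0)"
proof (cases x)
  case True
  then show ?thesis
    using online_gain_nonneg[of s] by (simp add: level_rate_def offline_dual_def det_step_def)
next
  case False
  then show ?thesis
    using offline_dual_nonneg[of s] by (simp add: level_rate_def det_step_def)
qed

end

section \<open>The assignment rule\<close>

text \<open>Finitely many states bound the integrand, and it vanishes above both \<open>W\<close>
  and \<open>a\<close>, so its support is bounded.\<close>

lemma set_integrable_level:
  fixes f :: "real \<Rightarrow> 's" and \<phi> :: "bool \<Rightarrow> 's \<Rightarrow> real"
  assumes "f \<in> borel \<rightarrow>\<^sub>M count_space UNIV" and "finite (range f)"
    and "\<And>w. w > W \<Longrightarrow> f w = s\<^sub>0" and "\<phi> False s\<^sub>0 = 0"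
  shows "set_integrable lborel {0<..} (\<lambda>w. \<phi> (w \<le> a) (f w))"
proof -
  let ?g = "\<lambda>w. \<phi> (w \<le> a) (f w)"
  define B where "B = Max ((\<lambda>(b, s). \<bar>\<phi> b s\<bar>) ` (UNIV \<times> range f))"
  have bound: "\<bar>?g w\<bar> \<le> B" for w
    unfolding B_def by (rule Max_ge) (use assms(2) in auto)
  have [measurable]: "(\<lambda>w. \<phi> b (f w)) \<in> borel_measurable borel" for b
    using measurable_compose[OF assms(1), of "\<phi> b" borel] by simp
  have "?g = (\<lambda>w. if w \<le> a then \<phi> True (f w) else \<phi> False (f w))"
    by auto
  then have "?g \<in> borel_measurable borel"
    by simp
  then have "set_integrable lborel {0<..max W (max 0 a)} ?g"
    unfolding set_integrable_def using bound
    by (intro integrableI_bounded_set_indicator[where B = B]) (auto simp: emeasure_lborel_Ioc le_max_iff_disj)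
  moreover have "indicator {0<..max W (max 0 a)} w *\<^sub>R ?g w = indicator {0<..} w *\<^sub>R ?g w" for w
    using assms(3,4) by (cases "w \<le> max W (max 0 a)") (auto simp: indicator_def le_max_iff_disj not_le)
  ultimately show ?thesis
    by (simp only: set_integrable_def)
qed

lemma set_integral_indicator_le:
  assumes "0 \<le> (a :: real)"
  shows "(LINT w:{0<..}|lborel. if w \<le> a then c else 0) = c * a"
proof -
  have "(LINT w:{0<..}|lborel. if w \<le> a then c else 0) = (LINT w|lborel. c * indicator {0<..a} w)"
    unfolding set_lebesgue_integral_def by (intro Bochner_Integration.integral_cong) (auto simp: indicator_def)
  also have "\<dots> = c * a"
    using assms by simp
  finally show ?thesis .
qed

datatype assignment = Rand nat nat | Det nat

fun update_level :: "assignment \<Rightarrow> nat \<Rightarrow> bool \<Rightarrow> level_state \<Rightarrow> level_state" where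
  "update_level (Rand i1 i2) i x s = (if i = i1 \<or> i = i2 then rand_step x s else s)"
| "update_level (Det i1) i x s = (if i = i1 then det_step x s else s)"

fun online_dual :: "(nat \<Rightarrow> real) \<Rightarrow> assignment \<Rightarrow> real" where
  "online_dual R (Rand i1 i2) = R i1 + R i2"
| "online_dual R (Det i) = 4 / 3 * R i"

lemma ex_top_two:
  fixes R :: "nat \<Rightarrow> real"
  assumes "2 \<le> N"
  shows "\<exists>i1 i2. i1 < N \<and> i2 < N \<and> i1 \<noteq> i2 \<and> R i2 \<le> R i1 \<and> (\<forall>i<N. i \<noteq> i1 \<longrightarrow> R i \<le> R i2)"
proof -
  have max: "\<exists>i\<in>A. \<forall>j\<in>A. R j \<le> R i" if "finite A" "A \<noteq> {}" for A
    using Max_in[of "R ` A"] Max_ge[of "R ` A"] that by fastforce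
  obtain i1 where i1: "i1 < N" "\<forall>j<N. R j \<le> R i1"
    using max[of "{..<N}"] assms by (auto simp: lessThan_empty_iff)
  have "card ({..<N} - {i1}) > 0"
    using assms i1 by simp
  then have "{..<N} - {i1} \<noteq> {}"
    by force
  then obtain i2 where "i2 \<in> {..<N} - {i1}" "\<forall>j\<in>{..<N} - {i1}. R j \<le> R i2"
    using max[of "{..<N} - {i1}"] by auto
  with i1 show ?thesis
    by (intro exI[of _ i1] exI[of _ i2]) auto
qed

definition top_two :: "nat \<Rightarrow> (nat \<Rightarrow> real) \<Rightarrow> nat \<times> nat" where
  "top_two N R = (SOME (i1, i2). i1 < N \<and> i2 < N \<and> i1 \<noteq> i2 \<and> R i2 \<le> R i1 \<and>
     (\<forall>i<N. i \<noteq> i1 \<longrightarrow> R i \<le> R i2))"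

text \<open>Takes the option with the larger \<open>online_dual\<close>, which is therefore at least
  both \<open>4 / 3 * R i1\<close> and \<open>R i1 + R i2\<close>.\<close>

definition decide :: "nat \<Rightarrow> (nat \<Rightarrow> real) \<Rightarrow> assignment" where
  "decide N R = (case top_two N R of (i1, i2) \<Rightarrow>
     if 4 / 3 * R i1 \<le> R i1 + R i2 then Rand i1 i2 else Det i1)"

lemma decide_cases:
  assumes "2 \<le> N"
  obtains (rand) i1 i2 where "decide N R = Rand i1 i2" "i1 < N" "i2 < N" "i1 \<noteq> i2" "R i2 \<le> R i1"
      "\<forall>i<N. i \<noteq> i1 \<longrightarrow> R i \<le> R i2" "4 / 3 * R i1 \<le> R i1 + R i2"
    | (det) i1 i2 where "decide N R = Det i1" "i1 < N" "i2 < N" "i1 \<noteq> i2" "R i2 \<le> R i1"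
      "\<forall>i<N. i \<noteq> i1 \<longrightarrow> R i \<le> R i2" "R i1 + R i2 \<le> 4 / 3 * R i1"
proof -
  obtain i1 i2 where p: "top_two N R = (i1, i2)"
    by force
  have "\<exists>p. case p of (i1, i2) \<Rightarrow> i1 < N \<and> i2 < N \<and> i1 \<noteq> i2 \<and> R i2 \<le> R i1 \<and>
      (\<forall>i<N. i \<noteq> i1 \<longrightarrow> R i \<le> R i2)"
    using ex_top_two[OF assms, of R] by simp
  from someI_ex[OF this] have "case top_two N R of (i1, i2) \<Rightarrow> i1 < N \<and> i2 < N \<and> i1 \<noteq> i2 \<and>
      R i2 \<le> R i1 \<and> (\<forall>i<N. i \<noteq> i1 \<longrightarrow> R i \<le> R i2)"
    unfolding top_two_def .
  then show ?thesis
    using that[of i1 i2] p by (cases "4 / 3 * R i1 \<le> R i1 + R i2") (auto simp: decide_def)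
qed

section \<open>The process integrated over all levels, and its dual solution\<close>

locale matching_process = level_analysis +
  fixes N :: nat
  assumes two_le_N: "2 \<le> N"
begin

definition rate :: "(nat \<Rightarrow> real \<Rightarrow> level_state) \<Rightarrow> (nat \<Rightarrow> real) \<Rightarrow> nat \<Rightarrow> real" where
  "rate \<sigma> u i = (LINT w:{0<..}|lborel. level_rate (w \<le> u i) (\<sigma> i w))"

primrec state :: "(nat \<Rightarrow> nat \<Rightarrow> real) \<Rightarrow> nat \<Rightarrow> nat \<Rightarrow> real \<Rightarrow> level_state" where
  "state v 0 = (\<lambda>i w. Live 0 0 False)"
| "state v (Suc t) = (\<lambda>i w.
    update_level (decide N (rate (state v t) (v t))) i (w \<le> v t i) (state v t i w))"

definition rates :: "(nat \<Rightarrow> nat \<Rightarrow> real) \<Rightarrow> nat \<Rightarrow> nat \<Rightarrow> real" where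
  "rates v t = rate (state v t) (v t)"

definition decision :: "(nat \<Rightarrow> nat \<Rightarrow> real) \<Rightarrow> nat \<Rightarrow> assignment" where
  "decision v t = decide N (rates v t)"

text \<open>\<open>\<beta>\<close> and \<open>\<alpha>\<close> are the online and offline variables
  of a dual solution of the matching linear program, feasible up to the factor
  \<open>\<Gamma>\<close>; \<open>total_surplus\<close> is the budget for
  \<open>\<beta>\<close>.\<close>

definition \<beta> :: "(nat \<Rightarrow> nat \<Rightarrow> real) \<Rightarrow> nat \<Rightarrow> real" where
  "\<beta> v t = online_dual (rates v t) (decision v t)"

definition \<alpha> :: "(nat \<Rightarrow> nat \<Rightarrow> real) \<Rightarrow> nat \<Rightarrow> nat \<Rightarrow> real" where
  "\<alpha> v t i = (LINT w:{0<..}|lborel. offline_dual (state v t i w))"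

definition total_surplus :: "(nat \<Rightarrow> nat \<Rightarrow> real) \<Rightarrow> nat \<Rightarrow> nat \<Rightarrow> real" where
  "total_surplus v t i = (LINT w:{0<..}|lborel. surplus (state v t i w))"

lemma state_Suc:
  "state v (Suc t) i w = update_level (decision v t) i (w \<le> v t i) (state v t i w)"
  by (simp add: decision_def rates_def)

lemma state_cong: "(\<And>s. s < t \<Longrightarrow> v s = v' s) \<Longrightarrow> state v t = state v' t"
  by (induction t) simp_all

text \<open>Causality: later weights have no influence. This makes the queries of a longer input
  extend those of a shorter one.\<close>

lemma decision_cong: "(\<And>s. s \<le> t \<Longrightarrow> v s = v' s) \<Longrightarrow> decision v t = decision v' t"
  using state_cong[of t v v'] by (simp add: decision_def rates_def)

lemma level_valid_state: "level_valid (state v t i w)"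
proof (induction t)
  case (Suc t)
  then show ?case
    unfolding state_Suc
    by (cases "decision v t") (auto simp: level_valid_rand_step level_valid_det_step)
qed simp

lemma state_initial:
  assumes "\<And>s. s < t \<Longrightarrow> v s i < w"
  shows "state v t i w = Live 0 0 False"
  using assms
proof (induction t)
  case (Suc t)
  then have "state v t i w = Live 0 0 False" "\<not> w \<le> v t i"
    by (auto simp: not_le)
  then show ?case
    unfolding state_Suc by (cases "decision v t") (auto simp: det_step_def)
qed simp

lemma ex_state_initial: "\<exists>W. \<forall>w>W. state v t i w = Live 0 0 False"
proof (intro exI[of _ "Max (insert 0 ((\<lambda>s. v s i) ` {..<t}))"] allI impI state_initial)
  fix w s assume "Max (insert 0 ((\<lambda>s. v s i) ` {..<t})) < w" "s < t"
  then show "v s i < w"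
    by simp
qed

lemma state_finite_measurable:
  "finite (range (state v t i)) \<and> state v t i \<in> borel \<rightarrow>\<^sub>M count_space UNIV"
proof (induction t)
  case (Suc t)
  let ?up = "\<lambda>b. update_level (decision v t) i b"
  have sub: "state v (Suc t) i w \<in> case_prod ?up ` (UNIV \<times> range (state v t i))" for w
    unfolding state_Suc by (intro image_eqI[where x = "(w \<le> v t i, state v t i w)"]) auto
  have "finite (case_prod ?up ` (UNIV \<times> range (state v t i)))"
    using Suc by (intro finite_imageI[OF finite_cartesian_product]) auto
  then have "finite (range (state v (Suc t) i))"
    by (rule finite_subset[OF image_subsetI[OF sub]])
  moreover have up: "(\<lambda>w. ?up b (state v t i w)) \<in> borel \<rightarrow>\<^sub>M count_space UNIV" for b
    using measurable_compose[OF conjunct2[OF Suc], of "?up b" "count_space UNIV"] by simp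
  have "{w \<in> space borel. w \<le> v t i} \<in> sets borel"
    by measurable
  from measurable_If[OF up[of True] up[of False] this] have "state v (Suc t) i \<in> borel \<rightarrow>\<^sub>M count_space UNIV"
    by (rule measurable_cong[THEN iffD1, rotated]) (simp add: state_Suc del: state.simps)
  ultimately show ?case
    by blast
qed simp

lemma set_integrable_state:
  assumes "\<phi> False (Live 0 0 False) = (0 :: real)"
  shows "set_integrable lborel {0<..} (\<lambda>w. \<phi> (w \<le> a) (state v t i w))"
proof -
  obtain W where "\<forall>w>W. state v t i w = Live 0 0 False"
    using ex_state_initial by blast
  then show ?thesis
    using state_finite_measurable[of v t i] assms by (intro set_integrable_level) auto
qed

lemma offline_dual_initial [simp]: "offline_dual (Live 0 0 False) = 0"
  by (simp add: offline_dual_def gain_def)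

lemma surplus_initial [simp]: "surplus (Live 0 0 False) = 0"
  by (simp add: surplus_def)

lemma level_rate_initial [simp]: "level_rate False (Live 0 0 False) = 0"
  by (simp add: level_rate_def)

lemmas set_integrable_simps =
  set_integrable_state[of "\<lambda>_. offline_dual", simplified]
  set_integrable_state[of "\<lambda>_. surplus", simplified]
  set_integrable_state[of level_rate, simplified]

lemma rates_eq: "rates v t i = (LINT w:{0<..}|lborel. level_rate (w \<le> v t i) (state v t i w))"
  by (simp add: rates_def rate_def)

lemma total_surplus_Suc:
  "total_surplus v (Suc t) i - total_surplus v t i \<ge>
    (case decision v t of
      Rand i1 i2 \<Rightarrow> if i = i1 \<or> i = i2 then rates v t i else 0
    | Det i1 \<Rightarrow> if i = i1 then 4 / 3 * rates v t i else 0)"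
proof -
  define d where "d w = surplus (state v (Suc t) i w) - surplus (state v t i w)" for w
  have d_int: "set_integrable lborel {0<..} d"
    unfolding d_def by (intro set_integral_diff set_integrable_simps)
  have d: "total_surplus v (Suc t) i - total_surplus v t i = (LINT w:{0<..}|lborel. d w)"
    unfolding d_def total_surplus_def
    by (intro set_integral_diff(2)[symmetric] set_integrable_simps)
  \<comment> \<open>The multiple of the rate in all cases at once; it is 0 if \<open>i\<close> is
    not involved, since its states then stay unchanged.\<close>
  define c :: real where "c = (case decision v t of
      Rand i1 i2 \<Rightarrow> if i = i1 \<or> i = i2 then 1 else 0
    | Det i1 \<Rightarrow> if i = i1 then 4 / 3 else 0)"
  have "c * level_rate (w \<le> v t i) (state v t i w) \<le> d w" for w
    using surplus_rand_step[OF level_valid_state[of v t i w], of "w \<le> v t i"]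
      surplus_det_step[OF level_valid_state[of v t i w], of "w \<le> v t i"]
    unfolding d_def state_Suc by (cases "decision v t") (auto simp: c_def)
  then have "c * rates v t i \<le> (LINT w:{0<..}|lborel. d w)"
    unfolding rates_eq set_integral_mult_right[symmetric] using d_int
    by (intro set_integral_mono set_integrable_mult_right set_integrable_simps) auto
  then show ?thesis
    unfolding d by (cases "decision v t") (auto simp: c_def)
qed

lemma sum_total_surplus_Suc:
  "(\<Sum>i<N. total_surplus v (Suc t) i) \<ge> (\<Sum>i<N. total_surplus v t i) + \<beta> v t"
proof -
  let ?c = "\<lambda>i. case decision v t of
      Rand i1 i2 \<Rightarrow> if i = i1 \<or> i = i2 then rates v t i else 0
    | Det i1 \<Rightarrow> if i = i1 then 4 / 3 * rates v t i else 0"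
  have "(\<Sum>i<N. ?c i) = \<beta> v t"
  proof (rule decide_cases[OF two_le_N, of "rates v t"])
    fix i1 i2 assume *: "decide N (rates v t) = Rand i1 i2" "i1 < N" "i2 < N" "i1 \<noteq> i2"
    have "(\<Sum>i<N. if i = i1 \<or> i = i2 then rates v t i else 0) = (\<Sum>i\<in>{i1, i2}. rates v t i)"
      using * by (intro sum.mono_neutral_cong_right) auto
    then show ?thesis
      using * by (simp add: \<beta>_def decision_def)
  next
    fix i1 assume "decide N (rates v t) = Det i1" "i1 < N"
    then show ?thesis
      by (simp add: \<beta>_def decision_def)
  qed
  moreover have "(\<Sum>i<N. total_surplus v t i) + (\<Sum>i<N. ?c i) \<le> (\<Sum>i<N. total_surplus v (Suc t) i)"
    unfolding sum.distrib[symmetric] using total_surplus_Suc by (intro sum_mono) (simp add: le_diff_eq add.commute)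
  ultimately show ?thesis
    by simp
qed

lemma sum_total_surplus: "(\<Sum>t<T. \<beta> v t) \<le> (\<Sum>i<N. total_surplus v T i)"
proof (induction T)
  case 0
  then show ?case
    by (simp add: total_surplus_def)
next
  case (Suc T)
  then show ?case
    using sum_total_surplus_Suc[of v T] by simp
qed

lemma \<alpha>_mono: "t \<le> T \<Longrightarrow> \<alpha> v t i \<le> \<alpha> v T i"
proof (induction T rule: dec_induct)
  case (step T)
  have "offline_dual (state v T i w) \<le> offline_dual (state v (Suc T) i w)" for w
    unfolding state_Suc using offline_dual_mono_rand_step offline_dual_mono_det_step
    by (cases "decision v T") auto
  then have "\<alpha> v T i \<le> \<alpha> v (Suc T) i"
    unfolding \<alpha>_def by (intro set_integral_mono set_integrable_simps) auto
  with step show ?case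
    by simp
qed simp

lemma \<alpha>_nonneg: "0 \<le> \<alpha> v t i"
  unfolding \<alpha>_def set_lebesgue_integral_def
  by (intro integral_nonneg_AE AE_I2) (auto simp: offline_dual_nonneg)

text \<open>Integrates a levelwise bound. Taking \<open>t'\<close> to be \<open>t\<close> serves the
  ordinary bidders; taking \<open>Suc t\<close> lets the top bidder count the rise of its own
  dual.\<close>

lemma \<alpha>_plus_rates:
  assumes "0 \<le> v t i"
    and "\<And>w. (if w \<le> v t i then \<Gamma> else 0) \<le>
      offline_dual (state v t' i w) + c * level_rate (w \<le> v t i) (state v t i w)"
  shows "\<Gamma> * v t i \<le> \<alpha> v t' i + c * rates v t i"
proof -
  have "\<Gamma> * v t i = (LINT w:{0<..}|lborel. if w \<le> v t i then \<Gamma> else 0)"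
    using set_integral_indicator_le[OF assms(1)] by simp
  also have "\<dots> \<le> (LINT w:{0<..}|lborel.
      offline_dual (state v t' i w) + c * level_rate (w \<le> v t i) (state v t i w))"
    using set_integrable_state[of "\<lambda>x _. if x then \<Gamma> else 0" "v t i"] assms(2)
    by (intro set_integral_mono set_integral_add set_integrable_mult_right set_integrable_simps) auto
  also have "\<dots> = \<alpha> v t' i + c * rates v t i"
    unfolding \<alpha>_def rates_eq set_integral_mult_right[symmetric]
    by (intro set_integral_add set_integrable_mult_right set_integrable_simps)
  finally show ?thesis .
qed

text \<open>The decision makes \<open>\<beta> v t\<close> at least \<open>4 / 3\<close> of the top
  rate, enough for the top bidder, and at least the sum of the two top rates, hence twice the rate
  of any other vertex.\<close>

lemma dual_feasible:
  assumes "i < N" "t < T" "0 \<le> v t i"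
  shows "\<Gamma> * v t i \<le> \<alpha> v T i + \<beta> v t"
proof -
  have other: "\<Gamma> * v t i \<le> \<alpha> v T i + 2 * rates v t i"
    using \<alpha>_plus_rates[of v t i t 2] \<alpha>_mono[of t T v i] assms
    by (simp add: offline_dual_plus_rate)
  have top: "\<Gamma> * v t i \<le> \<alpha> v T i + 4 / 3 * rates v t i"
    if "\<exists>i2. decision v t = Rand i i2 \<or> decision v t = Det i"
    using \<alpha>_plus_rates[of v t i "Suc t" "4 / 3"] \<alpha>_mono[of "Suc t" T v i] assms that
      offline_dual_rand_step_plus_rate offline_dual_det_step_plus_rate
    by (fastforce simp: state_Suc simp del: state.simps)
  show ?thesis
  proof (rule decide_cases[OF two_le_N, of "rates v t"])
    fix i1 i2 assume *: "decide N (rates v t) = Rand i1 i2" "rates v t i2 \<le> rates v t i1"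
      "\<forall>i<N. i \<noteq> i1 \<longrightarrow> rates v t i \<le> rates v t i2"
      "4 / 3 * rates v t i1 \<le> rates v t i1 + rates v t i2"
    show ?thesis
      using * top other assms(1) by (cases "i = i1") (force simp: \<beta>_def decision_def)+
  next
    fix i1 i2 assume *: "decide N (rates v t) = Det i1" "rates v t i2 \<le> rates v t i1"
      "\<forall>i<N. i \<noteq> i1 \<longrightarrow> rates v t i \<le> rates v t i2"
      "rates v t i1 + rates v t i2 \<le> 4 / 3 * rates v t i1"
    show ?thesis
      using * top other assms(1) by (cases "i = i1") (force simp: \<beta>_def decision_def)+
  qed
qed

text \<open>Rates can be negative. Two vertices of constant weight 0 have rate 0, which forces the
  second largest rate to be nonnegative.\<close>

lemma \<beta>_nonneg:
  assumes "d1 < N" "d2 < N" "d1 \<noteq> d2" and "\<And>s. s \<le> t \<Longrightarrow> v s d1 = 0 \<and> v s d2 = 0"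
  shows "0 \<le> \<beta> v t"
proof -
  have "rates v t d = 0" if "d = d1 \<or> d = d2" for d
  proof -
    have "indicator {0<..} w *\<^sub>R level_rate (w \<le> v t d) (state v t d w) = 0" for w :: real
      using assms(4) that state_initial[of t v d w] by (cases "w > 0") auto
    then show ?thesis
      unfolding rates_eq set_lebesgue_integral_def by (intro integral_eq_zero_AE AE_I2)
  qed
  then have zero: "rates v t d1 = 0" "rates v t d2 = 0"
    by auto
  show ?thesis
  proof (rule decide_cases[OF two_le_N, of "rates v t"])
    fix i1 i2 assume *: "decide N (rates v t) = Rand i1 i2" "rates v t i2 \<le> rates v t i1"
      "\<forall>i<N. i \<noteq> i1 \<longrightarrow> rates v t i \<le> rates v t i2"
    then show ?thesis
      using assms zero by (cases "d1 = i1") (force simp: \<beta>_def decision_def)+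
  next
    fix i1 i2 assume *: "decide N (rates v t) = Det i1" "rates v t i2 \<le> rates v t i1"
      "\<forall>i<N. i \<noteq> i1 \<longrightarrow> rates v t i \<le> rates v t i2"
    then show ?thesis
      using assms zero by (cases "d1 = i1") (force simp: \<beta>_def decision_def)+
  qed
qed

end

section \<open>The guarantee of the OCS\<close>

lemma finite_set_pmf_run:
  assumes "\<And>h x. x \<in> set xs \<Longrightarrow> finite (set_pmf (alg h x))"
  shows "finite (set_pmf (run alg xs))"
proof -
  have "finite (set_pmf (run_from alg h xs))" for h
    using assms by (induction xs arbitrary: h) auto
  then show ?thesis
    by (simp add: run_def)
qed

text \<open>The layer-cake formula; with finite support it is an exchange of a finite sum and an
  integral.\<close>

lemma expectation_eq_integral_tail:
  fixes X :: "'a \<Rightarrow> real"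
  assumes fin: "finite (set_pmf p)" and nonneg: "\<And>x. 0 \<le> X x"
  shows "set_integrable lborel {0<..} (\<lambda>w. measure_pmf.prob p {x. w \<le> X x})"
    and "measure_pmf.expectation p X = (LINT w:{0<..}|lborel. measure_pmf.prob p {x. w \<le> X x})"
proof -
  have prob: "measure_pmf.prob p {x. w \<le> X x} = (\<Sum>x\<in>set_pmf p. if w \<le> X x then pmf p x else 0)" for w
  proof -
    have "measure_pmf.prob p {x. w \<le> X x} = measure_pmf.prob p (set_pmf p \<inter> {x. w \<le> X x})"
      unfolding Int_commute[of "set_pmf p"] measure_Int_set_pmf ..
    also have "\<dots> = (\<Sum>x\<in>set_pmf p. if w \<le> X x then pmf p x else 0)"
      using fin by (simp add: measure_measure_pmf_finite sum.inter_restrict)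
    finally show ?thesis .
  qed
  have int: "set_integrable lborel {0<..} (\<lambda>w. if w \<le> a then c else 0)" for a c :: real
    using set_integrable_level[of "\<lambda>_. ()" 0 "()" "\<lambda>b _. if b then c else 0" a] by simp
  show "set_integrable lborel {0<..} (\<lambda>w. measure_pmf.prob p {x. w \<le> X x})"
    unfolding prob using int unfolding set_integrable_def scaleR_sum_right
    by (intro Bochner_Integration.integrable_sum)
  have "(LINT w:{0<..}|lborel. measure_pmf.prob p {x. w \<le> X x}) =
      (\<Sum>x\<in>set_pmf p. LINT w:{0<..}|lborel. if w \<le> X x then pmf p x else 0)"
    unfolding prob using int unfolding set_lebesgue_integral_def set_integrable_def scaleR_sum_right
    by (intro Bochner_Integration.integral_sum)
  also have "\<dots> = (\<Sum>x\<in>set_pmf p. X x * pmf p x)"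
    by (simp add: set_integral_indicator_le nonneg mult.commute)
  also have "\<dots> = measure_pmf.expectation p X"
    using fin by (intro integral_measure_pmf_real[symmetric]) auto
  finally show "measure_pmf.expectation p X = (LINT w:{0<..}|lborel. measure_pmf.prob p {x. w \<le> X x})"
    by simp
qed

context matching_process
begin

text \<open>
  Every assignment is followed by a dummy query, so that a single randomized assignment already
  spans two time steps and hence a consecutive set.
\<close>

definition query :: "(nat \<Rightarrow> nat \<Rightarrow> real) \<Rightarrow> nat \<Rightarrow> nat multiset" where
  "query v j = (case decision v (j div 2) of
     Rand i1 i2 \<Rightarrow> if even j then {#i1, i2#} else {#N, Suc N#}
   | Det _ \<Rightarrow> {#N, Suc N#})"

definition winner :: "(nat \<Rightarrow> nat \<Rightarrow> real) \<Rightarrow> ('x \<times> nat) list \<Rightarrow> nat \<Rightarrow> nat" where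
  "winner v h t = (case decision v t of Rand _ _ \<Rightarrow> snd (h ! (2 * t)) | Det i \<Rightarrow> i)"

definition winning_weight :: "(nat \<Rightarrow> nat \<Rightarrow> real) \<Rightarrow> nat \<Rightarrow> ('x \<times> nat) list \<Rightarrow> nat \<Rightarrow> real" where
  "winning_weight v T h i = Max (insert 0 {v t i | t. t < T \<and> winner v h t = i})"

lemma query_cong: "(\<And>s. s \<le> j div 2 \<Longrightarrow> v s = v' s) \<Longrightarrow> query v j = query v' j"
  using decision_cong[of "j div 2" v v'] by (simp add: query_def)

lemma query_valid: "size (query v j) = 2 \<and> set_mset (query v j) \<subseteq> {..<N + 2}"
  unfolding query_def decision_def
  by (rule decide_cases[OF two_le_N, of "rates v (j div 2)"]) auto

lemma query_count:
  assumes "i < N"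
  shows "count (query v j) i =
    (case decision v (j div 2) of Rand i1 i2 \<Rightarrow> of_bool (even j \<and> (i = i1 \<or> i = i2)) | Det _ \<Rightarrow> 0)"
  unfolding query_def decision_def
  by (rule decide_cases[OF two_le_N, of "rates v (j div 2)"]) (use assms in auto)

section \<open>Consecutive sets of time steps realising the runs\<close>

definition appearances :: "(nat \<Rightarrow> nat \<Rightarrow> real) \<Rightarrow> nat \<Rightarrow> nat set \<Rightarrow> nat" where
  "appearances v i S = (\<Sum>j\<in>S. count (query v j) i)"

text \<open>
  A run of assignments to \<open>i\<close> corresponds to an interval of time steps all of whose queries of \<open>i\<close> have
  weight at least \<open>w\<close>; the last interval is stretched to the present as long as it can be continued.
\<close>

definition blocks :: "(nat \<Rightarrow> nat \<Rightarrow> real) \<Rightarrow> nat \<Rightarrow> real \<Rightarrow> nat \<Rightarrow> nat \<Rightarrow> nat \<Rightarrow> bool \<Rightarrow> (nat \<Rightarrow> nat set) \<Rightarrow> bool"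
where
  "blocks v i w t k m c S \<longleftrightarrow>
     (\<forall>l<m. consecutive (S l) \<and> S l \<subseteq> {..<2 * t} \<and> 0 < appearances v i (S l) \<and>
        (\<forall>j\<in>S l. i \<in># query v j \<longrightarrow> w \<le> v (j div 2) i)) \<and>
     disjoint_family_on S {..<m} \<and>
     (\<Prod>l<m. miss_bound (appearances v i (S l))) = miss (Live k m c) \<and>
     (c \<longrightarrow> (\<exists>a. S (m - 1) = {a..<2 * t}))"

lemma disjoint_family_on_fun_upd:
  assumes "disjoint_family_on S {..<m}" and "\<And>l. l < m \<Longrightarrow> S l \<inter> A = {}"
  shows "disjoint_family_on (S(m := A)) {..<Suc m}"
proof -
  have "disjoint_family_on (S(m := A)) {..<m}"
    using assms(1) by (simp add: disjoint_family_on_def)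
  then show ?thesis
    using assms(2) by (force simp: lessThan_Suc disjoint_family_on_insert)
qed

lemma consecutive_atLeastLessThan: "Suc a < b \<Longrightarrow> consecutive {a..<b}"
  unfolding consecutive_def by (intro exI[of _ a] exI[of _ "b - 1"]) auto

lemma blocks_fun_upd:
  assumes S: "\<forall>l<m. consecutive (S l) \<and> S l \<subseteq> {..<2 * t} \<and> 0 < appearances v i (S l) \<and>
      (\<forall>j\<in>S l. i \<in># query v j \<longrightarrow> w \<le> v (j div 2) i)" "disjoint_family_on S {..<m}"
    and A: "A = {a..<2 * Suc t}" "consecutive A" "0 < appearances v i A"
      "\<forall>j\<in>A. i \<in># query v j \<longrightarrow> w \<le> v (j div 2) i" "\<And>l. l < m \<Longrightarrow> S l \<inter> A = {}"
    and prod: "(\<Prod>l<m. miss_bound (appearances v i (S l))) * miss_bound (appearances v i A)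
      = miss (Live k (Suc m) True)"
  shows "blocks v i w (Suc t) k (Suc m) True (S(m := A))"
  unfolding blocks_def
proof (intro conjI)
  show "\<forall>l<Suc m. consecutive ((S(m := A)) l) \<and> (S(m := A)) l \<subseteq> {..<2 * Suc t} \<and>
      0 < appearances v i ((S(m := A)) l) \<and>
      (\<forall>j\<in>(S(m := A)) l. i \<in># query v j \<longrightarrow> w \<le> v (j div 2) i)"
  proof (intro allI impI)
    fix l assume "l < Suc m"
    show "consecutive ((S(m := A)) l) \<and> (S(m := A)) l \<subseteq> {..<2 * Suc t} \<and>
        0 < appearances v i ((S(m := A)) l) \<and>
        (\<forall>j\<in>(S(m := A)) l. i \<in># query v j \<longrightarrow> w \<le> v (j div 2) i)"
    proof (cases "l = m")
      case True
      moreover have "A \<subseteq> {..<2 * Suc t}"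
        unfolding A(1) by auto
      ultimately show ?thesis
        using A(2-4) by simp
    next
      case False
      with \<open>l < Suc m\<close> have "l < m"
        by simp
      note Sl = spec[OF S(1), of l, THEN mp, OF this]
      moreover have "S l \<subseteq> {..<2 * Suc t}"
        using Sl by (elim conjE order_trans) auto
      ultimately show ?thesis
        unfolding fun_upd_other[OF False] by (elim conjE) (intro conjI)
    qed
  qed
  show "disjoint_family_on (S(m := A)) {..<Suc m}"
    by (rule disjoint_family_on_fun_upd[OF S(2) A(5)])
  show "(\<Prod>l<Suc m. miss_bound (appearances v i ((S(m := A)) l))) = miss (Live k (Suc m) True)"
    using prod by simp
  show "True \<longrightarrow> (\<exists>a. (S(m := A)) (Suc m - 1) = {a..<2 * Suc t})"
    by (auto simp: A(1))
qed

text \<open>The last interval is stretched over arrival \<open>t\<close> whether or not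
  \<open>i\<close> is queried: a query multiplies the bound by \<open>(1 - \<gamma>) / 2\<close>,
  and an idle arrival leaves it alone.\<close>

lemma blocks_extend:
  assumes S: "blocks v i w t k m True S" and m: "0 < m" "m \<le> k" and "i < N"
    and x: "i \<in># query v (2 * t) \<Longrightarrow> w \<le> v t i"
  shows "\<exists>S. blocks v i w (Suc t) (k + count (query v (2 * t)) i) m True S"
proof -
  define n where "n = count (query v (2 * t)) i"
  obtain m' where m': "m = Suc m'"
    using m by (cases m) auto
  obtain a where a: "S m' = {a..<2 * t}"
    using S m' by (auto simp: blocks_def)
  have last: "consecutive (S m')" "0 < appearances v i (S m')"
    "\<forall>j\<in>S m'. i \<in># query v j \<longrightarrow> w \<le> v (j div 2) i"
    using S m' by (auto simp: blocks_def)
  have "Suc a < 2 * t"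
  proof -
    obtain j1 j2 where "j1 < j2" "{a..<2 * t} = {j1..j2}"
      using last(1) unfolding a consecutive_def by blast
    then have "j1 \<in> {a..<2 * t}" "j2 \<in> {a..<2 * t}"
      by simp_all
    with \<open>j1 < j2\<close> show ?thesis
      by simp
  qed
  have odd: "count (query v (Suc (2 * t))) i = 0"
    unfolding query_count[OF \<open>i < N\<close>] by (auto split: assignment.split)
  have app: "appearances v i {a..<2 * Suc t} = appearances v i (S m') + n"
    using \<open>Suc a < 2 * t\<close> odd unfolding a appearances_def n_def by simp
  \<comment> \<open>Positivity of \<open>l\<close> matters: at \<open>l = 0\<close> the exponent
    \<open>l - 1\<close> truncates, and the first appearance contributes no factor
    \<open>1 - \<gamma>\<close>.\<close>
  have fac: "miss_bound (l + n) = miss_bound l * ((1 - \<gamma>) / 2) ^ n" if "0 < l" for l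
    using that by (cases l) (auto simp: miss_bound_def power_add power_divide)
  have "blocks v i w (Suc t) (k + n) (Suc m') True (S(m' := {a..<2 * Suc t}))"
  proof (rule blocks_fun_upd[OF _ _ refl])
    show "\<forall>l<m'. consecutive (S l) \<and> S l \<subseteq> {..<2 * t} \<and> 0 < appearances v i (S l) \<and>
        (\<forall>j\<in>S l. i \<in># query v j \<longrightarrow> w \<le> v (j div 2) i)"
      using S unfolding blocks_def m' by (meson less_SucI)
    show "disjoint_family_on S {..<m'}"
      using S unfolding blocks_def m' by (auto intro: disjoint_family_on_mono[rotated])
    show "consecutive {a..<2 * Suc t}"
      using \<open>Suc a < 2 * t\<close> by (intro consecutive_atLeastLessThan) simp
    show "0 < appearances v i {a..<2 * Suc t}"
      unfolding app using last(2) by simp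
    show "\<forall>j\<in>{a..<2 * Suc t}. i \<in># query v j \<longrightarrow> w \<le> v (j div 2) i"
    proof (intro ballI impI)
      fix j assume j: "j \<in> {a..<2 * Suc t}" "i \<in># query v j"
      then have "j \<noteq> Suc (2 * t)"
        using odd by (metis not_in_iff)
      with j(1) have "j \<in> S m' \<or> j = 2 * t"
        unfolding a by auto
      then show "w \<le> v (j div 2) i"
        using x last(3) j(2) by auto
    qed
    show "S l \<inter> {a..<2 * Suc t} = {}" if "l < m'" for l
    proof -
      have "S l \<inter> S m' = {}" "S l \<subseteq> {..<2 * t}"
        using S that unfolding blocks_def m' disjoint_family_on_def by auto
      then show ?thesis
        unfolding a by (auto simp: set_eq_iff)
    qed
    have "(\<Prod>l<m'. miss_bound (appearances v i (S l))) * miss_bound (appearances v i {a..<2 * Suc t}) =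
        miss (Live k m True) * ((1 - \<gamma>) / 2) ^ n"
      using S m' unfolding app fac[OF last(2)] by (auto simp: blocks_def)
    also have "\<dots> = miss (Live (k + n) (Suc m') True)"
    proof -
      have "k + n - m = k - m + n"
        using m by simp
      then show ?thesis
        unfolding m'[symmetric] by (simp add: power_add power_divide)
    qed
    finally show "(\<Prod>l<m'. miss_bound (appearances v i (S l))) *
        miss_bound (appearances v i {a..<2 * Suc t}) = miss (Live (k + n) (Suc m') True)" .
  qed
  then show ?thesis
    unfolding n_def m' by blast
qed

lemma blocks_new:
  assumes S: "blocks v i w t k m c S" and n: "count (query v (2 * t)) i = 1"
    and "i < N" and x: "w \<le> v t i"
  shows "\<exists>S. blocks v i w (Suc t) (Suc k) (Suc m) True S"
proof -
  have odd: "count (query v (Suc (2 * t))) i = 0"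
    unfolding query_count[OF \<open>i < N\<close>] by (auto split: assignment.split)
  have ivl: "{2 * t..<2 * Suc t} = {2 * t, Suc (2 * t)}"
    by auto
  have app: "appearances v i {2 * t..<2 * Suc t} = 1"
    unfolding ivl appearances_def using n odd by simp
  have "blocks v i w (Suc t) (Suc k) (Suc m) True (S(m := {2 * t..<2 * Suc t}))"
  proof (rule blocks_fun_upd[OF _ _ refl])
    show "\<forall>l<m. consecutive (S l) \<and> S l \<subseteq> {..<2 * t} \<and> 0 < appearances v i (S l) \<and>
        (\<forall>j\<in>S l. i \<in># query v j \<longrightarrow> w \<le> v (j div 2) i)" "disjoint_family_on S {..<m}"
      using S unfolding blocks_def by simp_all
    show "consecutive {2 * t..<2 * Suc t}"
      by (intro consecutive_atLeastLessThan) simp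
    show "0 < appearances v i {2 * t..<2 * Suc t}"
      unfolding app by simp
    show "\<forall>j\<in>{2 * t..<2 * Suc t}. i \<in># query v j \<longrightarrow> w \<le> v (j div 2) i"
      unfolding ivl using x by simp
    show "S l \<inter> {2 * t..<2 * Suc t} = {}" if "l < m" for l
      using S that unfolding blocks_def by fastforce
    show "(\<Prod>l<m. miss_bound (appearances v i (S l))) *
        miss_bound (appearances v i {2 * t..<2 * Suc t}) = miss (Live (Suc k) (Suc m) True)"
      using S unfolding app by (simp add: blocks_def miss_bound_def)
  qed
  then show ?thesis
    by blast
qed

lemma blocks_keep: "blocks v i w t k m c S \<Longrightarrow> blocks v i w (Suc t) k m False S"
  unfolding blocks_def by fastforce

text \<open>Links the counters of \<open>level_state\<close> to actual sets of time steps on which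
  the OCS guarantee can be invoked.\<close>

lemma ex_blocks:
  assumes "i < N" "state v t i w = Live k m c"
  shows "\<exists>S. blocks v i w t k m c S"
  using assms(2)
proof (induction t arbitrary: k m c)
  case 0
  then show ?case
    by (auto simp: blocks_def disjoint_family_on_def)
next
  case (Suc t)
  obtain k0 m0 c0 where s: "state v t i w = Live k0 m0 c0"
    using Suc.prems unfolding state_Suc
    by (cases "state v t i w"; cases "decision v t") (auto simp: det_step_def split: if_splits)
  obtain S where S: "blocks v i w t k0 m0 c0 S"
    using Suc.IH[OF s] by blast
  have valid: "m0 \<le> k0" "c0 \<Longrightarrow> 0 < m0"
    using level_valid_state[of v t i w] s by auto
  have cnt: "count (query v (2 * t)) i =
      (case decision v t of Rand i1 i2 \<Rightarrow> of_bool (i = i1 \<or> i = i2) | Det _ \<Rightarrow> 0)"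
    using query_count[OF assms(1), of v "2 * t"] by (cases "decision v t") simp_all
  define n where "n = count (query v (2 * t)) i"
  consider (play) "n = 1" "w \<le> v t i" "k = Suc k0" "m = (if c0 then m0 else Suc m0)" "c"
    | (low) "k = k0" "m = m0" "\<not> c" | (idle) "n = 0" "k = k0" "m = m0" "c = c0"
    using Suc.prems unfolding state_Suc s n_def cnt
    by (cases "decision v t") (auto simp: det_step_def split: if_splits)
  then show ?case
  proof cases
    case play
    then show ?thesis
      using blocks_extend[of v i w t k0 m0 S] blocks_new[of v i w t k0 m0 c0 S] S valid assms(1)
      by (cases c0) (auto simp: n_def)
  next
    case low
    then show ?thesis
      using blocks_keep[OF S] by auto
  next
    case idle
    show ?thesis
    proof (cases c0)
      case True
      \<comment> \<open>An open run must reach the present, so its interval absorbs the idle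
        arrival.\<close>
      have "i \<notin># query v (2 * t)"
        using idle by (simp add: n_def count_eq_zero_iff)
      then show ?thesis
        using blocks_extend[of v i w t k0 m0 S] S valid assms(1) idle True by (auto simp: n_def)
    next
      case False
      then show ?thesis
        using blocks_keep[OF S] idle by auto
    qed
  qed
qed

lemma state_DeadD: "state v T i w = Dead \<Longrightarrow> \<exists>t<T. decision v t = Det i \<and> w \<le> v t i"
proof (induction T)
  case (Suc T)
  show ?case
  proof (cases "state v T i w = Dead")
    case True
    then show ?thesis
      using Suc.IH less_SucI by blast
  next
    case False
    then show ?thesis
      using Suc.prems unfolding state_Suc
      by (cases "decision v T"; cases "state v T i w") (auto simp: det_step_def split: if_splits)
  qed
qed simp

lemma level_le_winning_weight:
  assumes "0 < w"
  shows "w \<le> winning_weight v T h i \<longleftrightarrow> (\<exists>t<T. winner v h t = i \<and> w \<le> v t i)"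
proof -
  have "finite {v t i | t. t < T \<and> winner v h t = i}"
    by simp
  then show ?thesis
    unfolding winning_weight_def using assms by (subst Max_ge_iff) auto
qed

lemma winning_weight_nonneg: "0 \<le> winning_weight v T h i"
  unfolding winning_weight_def by (rule Max_ge) auto

section \<open>From the OCS guarantee to expected winning weights\<close>

definition queries :: "(nat \<Rightarrow> nat \<Rightarrow> real) \<Rightarrow> nat \<Rightarrow> nat multiset list" where
  "queries v T = map (query v) [0..<2 * T]"

lemma queries_valid: "A \<in> set (queries v T) \<Longrightarrow> size A = 2 \<and> set_mset A \<subseteq> {..<N + 2}"
  using query_valid by (auto simp: queries_def)

lemma length_queries [simp]: "length (queries v T) = 2 * T"
  by (simp add: queries_def)

lemma OCS_selects:
  assumes "gamma_OCS \<gamma> {..<N + 2} ocs" "A \<in> set (queries v T)"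
  shows "set_pmf (ocs h A) \<subseteq> set_mset A"
  using assms queries_valid[OF assms(2)] unfolding gamma_OCS_def two_discrete_OCS_def by blast

text \<open>A dead level is reached with certainty. At a live one the OCS bound for the union of the
  blocks is exactly \<open>miss\<close>.\<close>

lemma prob_winning_weight:
  assumes ocs: "gamma_OCS \<gamma> {..<N + 2} ocs" and "i < N" and "0 < w"
  shows "measure_pmf.prob (run ocs (queries v T)) {h. w \<le> winning_weight v T h i}
    \<ge> 1 - miss (state v T i w)"
proof (cases "state v T i w")
  case Dead
  then obtain t where "t < T" "decision v t = Det i" "w \<le> v t i"
    using state_DeadD by blast
  then have "w \<le> winning_weight v T h i" for h :: "(nat multiset \<times> nat) list"
    unfolding level_le_winning_weight[OF assms(3)] by (intro exI[of _ t]) (simp add: winner_def)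
  then show ?thesis
    using Dead by simp
next
  case (Live k m c)
  let ?p = "measure_pmf.prob (run ocs (queries v T))"
  obtain S where S: "blocks v i w T k m c S"
    using ex_blocks[OF assms(2) Live] by blast
  have sub: "S l \<subseteq> {..<2 * T}" "consecutive (S l)" if "l < m" for l
    using S that by (auto simp: blocks_def)
  have cnt: "count_in (queries v T) i (S l) = appearances v i (S l)" if "l < m" for l
    unfolding count_in_def appearances_def queries_def using sub[OF that] by (intro sum.cong) auto
  have "(\<forall>A\<in>set (queries v T). size A = 2 \<and> set_mset A \<subseteq> {..<N + 2}) \<and> i \<in> {..<N + 2} \<and>
      (\<forall>l<m. consecutive (S l) \<and> S l \<subseteq> {..<length (queries v T)}) \<and> disjoint_family_on S {..<m}"
    using sub S queries_valid[of _ v T] assms(2) by (simp add: blocks_def)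
  then have "?p {h. \<forall>j\<in>(\<Union>l<m. S l). snd (h ! j) \<noteq> i} \<le>
      (\<Prod>l<m. (1 / 2) ^ count_in (queries v T) i (S l) * (1 - \<gamma>) ^ (count_in (queries v T) i (S l) - 1))"
    using ocs unfolding gamma_OCS_def by blast
  also have "\<dots> = (\<Prod>l<m. miss_bound (appearances v i (S l)))"
    by (intro prod.cong) (simp_all add: cnt miss_bound_def)
  also have "\<dots> = miss (Live k m c)"
    using S by (simp add: blocks_def)
  finally have bound: "?p {h. \<forall>j\<in>(\<Union>l<m. S l). snd (h ! j) \<noteq> i} \<le> miss (state v T i w)"
    using Live by simp
  \<comment> \<open>A win of \<open>i\<close> inside a block has weight at least \<open>w\<close>,
    so missing the level means losing throughout all blocks.\<close>
  have "?p {h. \<not> w \<le> winning_weight v T h i} \<le> ?p {h. \<forall>j\<in>(\<Union>l<m. S l). snd (h ! j) \<noteq> i}"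
  proof (intro measure_pmf.finite_measure_mono_AE AE_pmfI impI)
    fix h assume h: "h \<in> set_pmf (run ocs (queries v T))" "h \<in> {h. \<not> w \<le> winning_weight v T h i}"
    have "snd (h ! j) \<noteq> i" if "l < m" "j \<in> S l" for l j
    proof
      assume sel: "snd (h ! j) = i"
      have j: "j < 2 * T"
        using sub that by auto
      have "snd (h ! j) \<in># queries v T ! j"
        by (rule set_pmf_run_decision[OF _ h(1)]) (use OCS_selects[OF ocs] j in \<open>auto simp: queries_def\<close>)
      then have q: "i \<in># query v j"
        using j sel by (simp add: queries_def)
      then have "w \<le> v (j div 2) i"
        using S that by (auto simp: blocks_def)
      moreover have "winner v h (j div 2) = i"
      proof -
        have "count (query v j) i \<noteq> 0"
          using q by simp
        then show ?thesis
          using sel unfolding query_count[OF assms(2)] winner_def by (auto split: assignment.splits)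
      qed
      ultimately have "w \<le> winning_weight v T h i"
        unfolding level_le_winning_weight[OF assms(3)] using j by (intro exI[of _ "j div 2"]) auto
      with h(2) show False
        by simp
    qed
    then show "h \<in> {h. \<forall>j\<in>(\<Union>l<m. S l). snd (h ! j) \<noteq> i}"
      by auto
  qed simp
  moreover have "?p {h. \<not> w \<le> winning_weight v T h i} = 1 - ?p {h. w \<le> winning_weight v T h i}"
    using measure_pmf.prob_compl[of "{h. w \<le> winning_weight v T h i}" "run ocs (queries v T)"]
    by (simp add: Collect_neg_eq Compl_eq_Diff_UNIV)
  ultimately show ?thesis
    using bound by linarith
qed

text \<open>At each level, surplus plus offline dual is \<open>1 - miss - credit\<close>, at most
  the tail probability; integrating gives the claim.\<close>

lemma expectation_winning_weight:
  assumes ocs: "gamma_OCS \<gamma> {..<N + 2} ocs" and "i < N"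
  shows "measure_pmf.expectation (run ocs (queries v T)) (\<lambda>h. winning_weight v T h i)
    \<ge> total_surplus v T i + \<alpha> v T i"
proof -
  have fin: "finite (set_pmf (run ocs (queries v T)))"
    using OCS_selects[OF ocs] by (intro finite_set_pmf_run finite_subset[OF _ finite_set_mset])
  have "total_surplus v T i + \<alpha> v T i =
      (LINT w:{0<..}|lborel. surplus (state v T i w) + offline_dual (state v T i w))"
    unfolding total_surplus_def \<alpha>_def by (intro set_integral_add(2)[symmetric] set_integrable_simps)
  also have "\<dots> \<le> (LINT w:{0<..}|lborel.
      measure_pmf.prob (run ocs (queries v T)) {h. w \<le> winning_weight v T h i})"
  proof (rule set_integral_mono)
    fix w :: real assume "w \<in> {0<..}"
    then show "surplus (state v T i w) + offline_dual (state v T i w) \<le>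
        measure_pmf.prob (run ocs (queries v T)) {h. w \<le> winning_weight v T h i}"
      using prob_winning_weight[OF assms, of w v T] credit_nonneg[of "state v T i w"]
      by (simp add: surplus_def)
  qed (intro set_integral_add set_integrable_simps expectation_eq_integral_tail fin winning_weight_nonneg)+
  finally show ?thesis
    by (simp add: expectation_eq_integral_tail(2)[OF fin winning_weight_nonneg])
qed

end

section \<open>The competitive ratio\<close>

context matching_process
begin

text \<open>Weak duality: approximate feasibility is summed over the matched pairs, nonnegativity
  extends the sums to all vertices, and the surplus pays for the online duals.\<close>

lemma expected_winning_weights_ge_matching:
  assumes ocs: "gamma_OCS \<gamma> {..<N + 2} ocs"
    and nonneg: "\<And>t i. 0 \<le> v t i"
    and "d1 < N" "d2 < N" "d1 \<noteq> d2" and zero: "\<And>t. v t d1 = 0 \<and> v t d2 = 0"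
    and M: "M \<subseteq> {..<N} \<times> {..<T}" "inj_on fst M" "inj_on snd M"
  shows "\<Gamma> * (\<Sum>(i, t)\<in>M. v t i) \<le>
    (\<Sum>i<N. measure_pmf.expectation (run ocs (queries v T)) (\<lambda>h. winning_weight v T h i))"
proof -
  have beta: "0 \<le> \<beta> v t" for t
    using \<beta>_nonneg[of d1 d2 t v] assms by simp
  have "\<Gamma> * (\<Sum>(i, t)\<in>M. v t i) = (\<Sum>p\<in>M. \<Gamma> * v (snd p) (fst p))"
    by (simp add: sum_distrib_left case_prod_beta)
  also have "\<dots> \<le> (\<Sum>p\<in>M. \<alpha> v T (fst p) + \<beta> v (snd p))"
    using M(1) nonneg by (intro sum_mono dual_feasible) auto
  also have "\<dots> = (\<Sum>i\<in>fst ` M. \<alpha> v T i) + (\<Sum>t\<in>snd ` M. \<beta> v t)"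
    using M by (simp add: sum.distrib sum.reindex)
  also have "\<dots> \<le> (\<Sum>i<N. \<alpha> v T i) + (\<Sum>t<T. \<beta> v t)"
    using M(1) \<alpha>_nonneg beta by (intro add_mono sum_mono2) auto
  also have "\<dots> \<le> (\<Sum>i<N. \<alpha> v T i) + (\<Sum>i<N. total_surplus v T i)"
    using sum_total_surplus[where v = v and T = T] by simp
  also have "\<dots> = (\<Sum>i<N. total_surplus v T i + \<alpha> v T i)"
    by (simp add: sum.distrib)
  also have "\<dots> \<le> (\<Sum>i<N. measure_pmf.expectation (run ocs (queries v T)) (\<lambda>h. winning_weight v T h i))"
    by (intro sum_mono expectation_winning_weight[OF ocs]) simp
  finally show ?thesis .
qed

lemma winner_cong:
  assumes "\<And>s. s \<le> t \<Longrightarrow> v s = v' s" and "h ! (2 * t) = h' ! (2 * t)"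
  shows "winner v h t = winner v' h' t"
  using assms decision_cong[of t v v'] by (simp add: winner_def split: assignment.split)

end

text \<open>The OCS history is private state, not determined by the visible assignments. The
  algorithm is therefore obtained from the laws of visible histories via
  \<open>ex_alg_run_eq\<close>.\<close>

lemma ex_competitive_online_alg:
  fixes L :: "'l set"
  assumes "0 < \<gamma>" "\<gamma> \<le> 1 / 3" and L: "finite L" and ocs: "gamma_OCS \<gamma> {..<card L + 4} ocs"
  shows "\<exists>alg :: ('l \<Rightarrow> real, 'l option) online_alg.
    (\<forall>h w. set_pmf (alg h w) \<subseteq> insert None (Some ` L)) \<and>
    (\<forall>ws. (\<forall>w\<in>set ws. \<forall>i\<in>L. 0 \<le> w i) \<longrightarrow>
      measure_pmf.expectation (run alg ws) (assigned_value L)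
        \<ge> (3 + 2 * \<gamma>) / (6 + 3 * \<gamma>) * optimal_matching_weight L ws)"
proof -
  define n where "n = card L"
  \<comment> \<open>Two extra vertices of weight 0 keep the second largest rate nonnegative.\<close>
  define N where "N = n + 2"
  interpret matching_process \<gamma> N
    using assms by unfold_locales (auto simp: N_def)
  have ocs: "gamma_OCS \<gamma> {..<N + 2} ocs"
    using ocs by (simp add: N_def n_def numeral_eq_Suc)
  obtain e where e: "bij_betw e L {..<n}"
    using ex_bij_betw_finite_nat[OF L] unfolding n_def atLeast0LessThan by blast
  define d where "d = inv_into L e"
  have d_mem: "d i \<in> L" and e_d: "e (d i) = i" if "i < n" for i
    using e that unfolding d_def bij_betw_def by (auto simp: inv_into_into f_inv_into_f)
  have d_e: "d (e i) = i" and e_less: "e i < n" if "i \<in> L" for i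
    using e that unfolding d_def bij_betw_def by auto
  define v where "v ws t i = (if t < length ws \<and> i < n then (ws ! t) (d i) else 0)"
    for ws :: "('l \<Rightarrow> real) list" and t i
  \<comment> \<open>Wins of the two added vertices, and any other winner outside
    \<open>{..<n}\<close>, become \<open>None\<close>.\<close>
  define decode where "decode ws h = map (\<lambda>t. (ws ! t,
      if winner (v ws) h t < n then Some (d (winner (v ws) h t)) else None)) [0..<length ws]"
    for ws :: "('l \<Rightarrow> real) list" and h :: "(nat multiset \<times> nat) list"
  define P where "P ws = map_pmf (decode ws) (run ocs (queries (v ws) (length ws)))" for ws
  have v_snoc: "v (ws @ [x]) t = v ws t" if "t < length ws" for ws x t
    using that by (auto simp: v_def fun_eq_iff nth_append)

  have "\<exists>alg. (\<forall>ws. run alg ws = P ws) \<and> (\<forall>h w. set_pmf (alg h w) \<subseteq> insert None (Some ` L))"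
  proof (rule ex_alg_run_eq[where d = None])
    show "map fst h = ws" if "h \<in> set_pmf (P ws)" for ws h
      using that by (auto simp: P_def decode_def comp_def map_nth)
    show "snd ` set h \<subseteq> insert None (Some ` L)" if "h \<in> set_pmf (P ws)" for ws h
      using that d_mem by (auto simp: P_def decode_def)
    show "map_pmf butlast (P (ws @ [x])) = P ws" for ws x
    proof -
      let ?Q = "queries (v ws) (length ws)"
      have query_eq: "query (v (ws @ [x])) j = query (v ws) j" if "j < 2 * length ws" for j
        using that by (intro query_cong v_snoc) auto
      obtain As where As: "queries (v (ws @ [x])) (length (ws @ [x])) = ?Q @ As"
      proof
        show "queries (v (ws @ [x])) (length (ws @ [x])) =
            ?Q @ map (query (v (ws @ [x]))) [2 * length ws..<2 * Suc (length ws)]"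
          using query_eq unfolding queries_def
          by (simp add: upt_add_eq_append[of 0 "2 * length ws" 2, simplified])
      qed
      \<comment> \<open>The assignment at arrival \<open>t\<close> depends only on weights up to
        \<open>t\<close> and on entry \<open>2 * t\<close> of the OCS history, so truncation
        commutes with decoding.\<close>
      have "butlast (decode (ws @ [x]) h) = decode ws (take (length ?Q) h)" for h
      proof -
        have "winner (v (ws @ [x])) h t = winner (v ws) (take (2 * length ws) h) t" if "t < length ws" for t
          using that by (intro winner_cong v_snoc) auto
        then show ?thesis
          by (auto simp: decode_def nth_append)
      qed
      then have "map_pmf butlast (P (ws @ [x])) = map_pmf (decode ws) (map_pmf (take (length ?Q)) (run ocs (?Q @ As)))"
        unfolding P_def As by (simp add: map_pmf_comp)
      then show ?thesis
        unfolding map_take_run P_def .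
    qed
  qed simp
  then obtain alg where alg: "\<And>ws. run alg ws = P ws" "\<And>h w. set_pmf (alg h w) \<subseteq> insert None (Some ` L)"
    by blast

  have "\<Gamma> * optimal_matching_weight L ws \<le> measure_pmf.expectation (run alg ws) (assigned_value L)"
    if nonneg: "\<forall>w\<in>set ws. \<forall>i\<in>L. 0 \<le> w i" for ws
  proof -
    let ?T = "length ws"
    let ?p = "run ocs (queries (v ws) ?T)"
    have assigned: "assigned_value L (decode ws h) = (\<Sum>i<n. winning_weight (v ws) ?T h i)" for h
    proof -
      have "{w i |w. (w, Some i) \<in> set (decode ws h)} = {v ws t (e i) |t. t < ?T \<and> winner (v ws) h t = e i}"
        if "i \<in> L" for i
      proof -
        have "winner (v ws) h t < n \<and> d (winner (v ws) h t) = i \<longleftrightarrow> winner (v ws) h t = e i" for t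
          using d_e[OF that] e_less[OF that] e_d by metis
        moreover have "(w, Some i) \<in> set (decode ws h) \<longleftrightarrow>
            (\<exists>t<?T. w = ws ! t \<and> winner (v ws) h t < n \<and> d (winner (v ws) h t) = i)" for w
          unfolding decode_def set_map set_upt image_iff Bex_def by (simp split: if_split) metis
        ultimately have "(w, Some i) \<in> set (decode ws h) \<longleftrightarrow>
            (\<exists>t<?T. w = ws ! t \<and> winner (v ws) h t = e i)" for w
          by simp
        moreover have "v ws t (e i) = (ws ! t) i" if "t < ?T" for t
          using that d_e[OF \<open>i \<in> L\<close>] e_less[OF \<open>i \<in> L\<close>] by (simp add: v_def)
        ultimately show ?thesis
          by (intro Collect_cong) metis
      qed
      then have "assigned_value L (decode ws h) = (\<Sum>i\<in>L. winning_weight (v ws) ?T h (e i))"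
        by (simp add: assigned_value_def winning_weight_def)
      also have "\<dots> = (\<Sum>i<n. winning_weight (v ws) ?T h i)"
        by (rule sum.reindex_bij_betw[OF e])
      finally show ?thesis .
    qed
    have dummy: "winning_weight (v ws) ?T h i = 0" if "n \<le> i" for h :: "(nat multiset \<times> nat) list" and i
    proof -
      have eq: "insert 0 {v ws t i |t. t < ?T \<and> winner (v ws) h t = i} = {0}"
        using that by (auto simp: v_def)
      show ?thesis
        unfolding winning_weight_def eq by simp
    qed
    have fin: "finite (set_pmf ?p)"
      using OCS_selects[OF ocs] by (intro finite_set_pmf_run finite_subset[OF _ finite_set_mset])
    have expectation: "measure_pmf.expectation (run alg ws) (assigned_value L) =
        (\<Sum>i<N. measure_pmf.expectation ?p (\<lambda>h. winning_weight (v ws) ?T h i))"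
    proof -
      have "measure_pmf.expectation (run alg ws) (assigned_value L) =
          measure_pmf.expectation ?p (\<lambda>h. \<Sum>i<n. winning_weight (v ws) ?T h i)"
        by (simp add: alg P_def assigned)
      also have "\<dots> = (\<Sum>i<n. measure_pmf.expectation ?p (\<lambda>h. winning_weight (v ws) ?T h i))"
        using fin by (intro Bochner_Integration.integral_sum integrable_measure_pmf_finite)
      also have "\<dots> = (\<Sum>i<N. measure_pmf.expectation ?p (\<lambda>h. winning_weight (v ws) ?T h i))"
      proof (rule sum.mono_neutral_left)
        show "{..<n} \<subseteq> {..<N}"
          by (simp add: N_def)
      qed (simp_all add: dummy)
      finally show ?thesis .
    qed
    have "is_matching L ?T {}"
      by (simp add: is_matching_def)
    moreover have "finite {M. is_matching L ?T M}"
      by (rule finite_subset[of _ "Pow (L \<times> {..<?T})"]) (use L in \<open>auto simp: is_matching_def\<close>)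
    ultimately have "optimal_matching_weight L ws \<in>
        (\<lambda>M. \<Sum>(i, j)\<in>M. (ws ! j) i) ` {M. is_matching L ?T M}"
      unfolding optimal_matching_weight_def by (intro Max_in) auto
    then obtain M where M: "is_matching L ?T M"
      and opt: "optimal_matching_weight L ws = (\<Sum>(i, j)\<in>M. (ws ! j) i)"
      by auto
    have M_sub: "M \<subseteq> L \<times> {..<?T}" and M_inj: "inj_on fst M" "inj_on snd M"
      using M by (auto simp: is_matching_def)
    let ?M = "map_prod e id ` M"
    have e_inj: "inj_on e L"
      using e by (simp add: bij_betw_def)
    have inj: "inj_on (map_prod e id) M"
      by (rule inj_on_subset[OF map_prod_inj_on[OF e_inj inj_on_id] M_sub])
    have "optimal_matching_weight L ws = (\<Sum>(i, t)\<in>?M. v ws t i)"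
      unfolding opt using M_sub d_e e_less
      by (subst sum.reindex[OF inj]) (auto simp: v_def intro!: sum.cong)
    moreover have "\<Gamma> * (\<Sum>(i, t)\<in>?M. v ws t i) \<le>
        (\<Sum>i<N. measure_pmf.expectation ?p (\<lambda>h. winning_weight (v ws) ?T h i))"
    proof (rule expected_winning_weights_ge_matching[OF ocs, of _ n "n + 1"])
      show "0 \<le> v ws t i" for t i
        using nonneg d_mem by (simp add: v_def)
      show "?M \<subseteq> {..<N} \<times> {..<?T}"
        using M_sub e_less by (fastforce simp: N_def)
      show "inj_on fst ?M"
      proof (rule inj_onI, clarsimp)
        fix i j i' j' assume *: "(i, j) \<in> M" "(i', j') \<in> M" "e i = e i'"
        then have "i = i'"
          using M_sub e_inj by (auto simp: inj_on_def)
        with * have "(i, j) = (i', j')"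
          by (intro inj_onD[OF M_inj(1)]) auto
        then show "j = j'"
          by simp
      qed
      show "inj_on snd ?M"
        using M_inj(2) by (force simp: inj_on_def)
    qed (auto simp: N_def v_def)
    ultimately show ?thesis
      unfolding expectation by simp
  qed
  then show ?thesis
    using alg(2) unfolding \<Gamma>_def by blast
qed

theorem mainTheorem2:
  fixes \<gamma> :: real
  assumes "0 < \<gamma>" and "\<gamma> < 1"
    and "\<And>G :: nat set. finite G \<Longrightarrow> \<exists>ocs. gamma_OCS \<gamma> G ocs"
  shows "\<exists>alg :: 'l matching_alg.
    is_matching_alg alg \<and> competitive ((3 + 2 * \<gamma>) / (6 + 3 * \<gamma>)) alg"
proof -
  \<comment> \<open>Three ground elements already force \<open>\<gamma> \<le> 1 / 3\<close>; for
    larger \<open>\<gamma>\<close> the hypothesis is contradictory.\<close>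
  obtain ocs where "gamma_OCS \<gamma> {..<3 :: nat} ocs"
    using assms(3) finite_lessThan by blast
  then have "\<gamma> \<le> 1 / 3"
    by (rule gamma_OCS_le_third[of _ _ _ 0 1 2]) auto
  \<comment> \<open>Finiteness stands inside the existential so that a single choice function covers
    every \<open>L\<close>.\<close>
  then have "\<exists>alg :: ('l \<Rightarrow> real, 'l option) online_alg. finite L \<longrightarrow>
      (\<forall>h w. set_pmf (alg h w) \<subseteq> insert None (Some ` L)) \<and>
      (\<forall>ws. (\<forall>w\<in>set ws. \<forall>i\<in>L. 0 \<le> w i) \<longrightarrow>
        measure_pmf.expectation (run alg ws) (assigned_value L)
          \<ge> (3 + 2 * \<gamma>) / (6 + 3 * \<gamma>) * optimal_matching_weight L ws)" for L :: "'l set"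
    using ex_competitive_online_alg[of \<gamma> L] assms(1) assms(3)[OF finite_lessThan, of "card L + 4"] by blast
  then obtain alg :: "'l matching_alg" where "\<And>L. finite L \<longrightarrow>
      (\<forall>h w. set_pmf (alg L h w) \<subseteq> insert None (Some ` L)) \<and>
      (\<forall>ws. (\<forall>w\<in>set ws. \<forall>i\<in>L. 0 \<le> w i) \<longrightarrow>
        measure_pmf.expectation (run (alg L) ws) (assigned_value L)
          \<ge> (3 + 2 * \<gamma>) / (6 + 3 * \<gamma>) * optimal_matching_weight L ws)"
    by metis
  then show ?thesis
    unfolding is_matching_alg_def competitive_def by blast
qed

end
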